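(* Suppose $\mathsf{p}\in\mathbb{R}[\mathcal{V}_n]$ is $\mathfrak{S}_n$-invariant and $d$-sos. For each partition $\bm{\lambda}\vdash n$, fix a tableau $\tau_{\bm{\lambda}}$ of shape $\bm{\lambda}$ and let $\{\mathsf{p}^{\tau_{\bm{\lambda}}}_1,\dots,\mathsf{p}^{\tau_{\bm{\lambda}}}_{l_{\tau_{\bm{\lambda}}}}\}$ be a set of polynomials whose span contains $W_{\tau_{\bm{\lambda}}}$. Then for each $\bm{\lambda}\in\Lambda$ there exists an $l_{\tau_{\bm{\lambda}}}\times l_{\tau_{\bm{\lambda}}}$ positive semidefinite matrix $R_{\bm{\lambda}}$ such that \[\mathsf{p}=\sum_{\bm{\lambda}\in\Lambda}\textup{tr}(R_{\bm{\lambda}}Z^{\tau_{\bm{\lambda}}}),\] where $Z^{\tau_{\bm{\lambda}}}_{ij}:=\textup{sym}(\mathsf{p}^{\tau_{\bm{\lambda}}}_i\mathsf{p}^{\tau_{\bm{\lambda}}}_j)$.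
   Context: Fix positive integers $n,d$. $\mathbb{R}[\mathsf{x}]$ is the polynomial ring in variables $\mathsf{x}_{ij}$, $1\le i<j\le n$ ($\mathsf{x}_{ji}:=\mathsf{x}_{ij}$); $\mathcal{V}_n=\{0,1\}^{\binom n2}$; $\mathcal{I}_n$ is the ideal generated by all $\mathsf{x}_{ij}^2-\mathsf{x}_{ij}$; $\mathbb{R}[\mathcal{V}_n]=\mathbb{R}[\mathsf{x}]/\mathcal{I}_n$ (functions on $\mathcal{V}_n$, identified with square-free polynomials), and $\mathbb{R}[\mathcal{V}_n]_{\le d}$ consists of those represented by polynomials of degree at most $d$. $\mathfrak{S}_n$ acts by ring automorphisms with $\mathfrak{s}\cdot\mathsf{x}_{ij}=\mathsf{x}_{\mathfrak{s}(i)\mathfrak{s}(j)}$; $\mathsf{p}$ is $\mathfrak{S}_n$-invariant if fixed by it. $\mathsf{p}$ is $d$-sos if $\mathsf{p}=\sum_k\mathsf{f}_k^2$ in $\mathbb{R}[\mathcal{V}_n]$ with $\mathsf{f}_k\in\mathbb{R}[\mathcal{V}_n]_{\le d}$. $\textup{sym}(\mathsf{f}):=\frac1{n!}\sum_{\mathfrak{s}\in\mathfrak{S}_n}\mathfrak{s}\cdot\mathsf{f}$. Let $V=\mathbb{R}[\mathcal{V}_n]_{\le d}$ with isotypic decomposition $V=\bigoplus_{\bm{\lambda}\vdash n}V_{\bm{\lambda}}$, where $V_{\bm{\lambda}}$ is the span of all submodules isomorphic to the irreducible module $S_{\bm{\lambda}}$. For a tableau $\tau_{\bm{\lambda}}$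 of shape $\bm{\lambda}$ (bijective filling of the Young diagram with $1,\dots,n$), its row group $\mathfrak{R}_{\tau_{\bm{\lambda}}}$ is the subgroup of $\mathfrak{S}_n$ preserving each row's set of labels, and $W_{\tau_{\bm{\lambda}}}:=V_{\bm{\lambda}}^{\mathfrak{R}_{\tau_{\bm{\lambda}}}}$ is the set of elements of $V_{\bm{\lambda}}$ fixed by the row group. $\Lambda:=\{\bm{\lambda}\vdash n:\bm{\lambda}\geq_{\textup{lex}}(n-2d,1^{2d})\}$ with $\geq_{\textup{lex}}$ the lexicographic order and $(n-2d,1^{2d})$ the hook partition with first part $n-2d$ and $2d$ parts equal to $1$. *)

theory Defs
  imports "HOL-Analysis.Analysis" "HOL-Combinatorics.Permutations"
begin

definition fspan :: "('a \<Rightarrow> real) set \<Rightarrow> ('a \<Rightarrow> real) set" where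
  "fspan A = {f. \<exists>B c. finite B \<and> B \<subseteq> A \<and> f = (\<lambda>x. \<Sum>b\<in>B. c b * b x)}"

definition fsubspace :: "('a \<Rightarrow> real) set \<Rightarrow> bool" where
  "fsubspace U \<longleftrightarrow> (\<lambda>x. 0) \<in> U \<and> (\<forall>f\<in>U. \<forall>g\<in>U. (\<lambda>x. f x + g x) \<in> U)
      \<and> (\<forall>c. \<forall>f\<in>U. (\<lambda>x. c * f x) \<in> U)"

text \<open>Vertices are 0..n-1; the variable x_ij (i<j) corresponds to the edge {i,j}.\<close>

definition Edges :: "nat \<Rightarrow> nat set set" where
  "Edges n = {{i, j} | i j. i < j \<and> j < n}"

text \<open>Points of V_n = {0,1}^(n choose 2) are identified with sets of edges (the support).\<close>
definition Vn :: "nat \<Rightarrow> nat set set set" where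
  "Vn n = Pow (Edges n)"

text \<open>R[V_n]: real functions on V_n, represented as functions vanishing outside V_n.\<close>
definition RVn :: "nat \<Rightarrow> (nat set set \<Rightarrow> real) set" where
  "RVn n = {f. \<forall>G. G \<notin> Vn n \<longrightarrow> f G = 0}"

text \<open>Square-free monomial x_S = prod_{e in S} x_e as a function on V_n.\<close>
definition monom :: "nat \<Rightarrow> nat set set \<Rightarrow> nat set set \<Rightarrow> real" where
  "monom n S G = (if G \<in> Vn n \<and> S \<subseteq> G then 1 else 0)"

definition Vdeg :: "nat \<Rightarrow> nat \<Rightarrow> (nat set set \<Rightarrow> real) set" where
  "Vdeg n d = fspan (monom n ` {S. S \<subseteq> Edges n \<and> card S \<le> d})"

definition d_sos :: "nat \<Rightarrow> nat \<Rightarrow> (nat set set \<Rightarrow> real) \<Rightarrow> bool" where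
  "d_sos n d p \<longleftrightarrow> (\<exists>fs. set fs \<subseteq> Vdeg n d \<and>
      (\<forall>G\<in>Vn n. p G = (\<Sum>f\<leftarrow>fs. (f G)\<^sup>2)))"

definition Sym :: "nat \<Rightarrow> (nat \<Rightarrow> nat) set" where
  "Sym n = {s. s permutes {0..<n}}"

text \<open>(s . x_ij) = x_{s(i) s(j)}; on functions: (s . f)(G) = f(s^{-1} G).\<close>
definition graph_act :: "(nat \<Rightarrow> nat) \<Rightarrow> nat set set \<Rightarrow> nat set set" where
  "graph_act s G = (\<lambda>e. s ` e) ` G"

definition act :: "(nat \<Rightarrow> nat) \<Rightarrow> (nat set set \<Rightarrow> real) \<Rightarrow> (nat set set \<Rightarrow> real)" where
  "act s f = (\<lambda>G. f (graph_act (inv s) G))"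

definition invariant :: "nat \<Rightarrow> (nat set set \<Rightarrow> real) \<Rightarrow> bool" where
  "invariant n f \<longleftrightarrow> (\<forall>s\<in>Sym n. act s f = f)"

definition symz :: "nat \<Rightarrow> (nat set set \<Rightarrow> real) \<Rightarrow> (nat set set \<Rightarrow> real)" where
  "symz n f = (\<lambda>G. (1 / fact n) * (\<Sum>s\<in>Sym n. act s f G))"

definition is_partition :: "nat \<Rightarrow> nat list \<Rightarrow> bool" where
  "is_partition n lam \<longleftrightarrow> sorted (rev lam) \<and> (\<forall>x\<in>set lam. 0 < x) \<and> sum_list lam = n"

definition cells :: "nat list \<Rightarrow> (nat \<times> nat) set" where
  "cells lam = {(r, c). r < length lam \<and> c < lam ! r}"

definition row_cells :: "nat list \<Rightarrow> nat \<Rightarrow> (nat \<times> nat) set" where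
  "row_cells lam r = {(r', c). r' = r \<and> r < length lam \<and> c < lam ! r}"

definition col_cells :: "nat list \<Rightarrow> nat \<Rightarrow> (nat \<times> nat) set" where
  "col_cells lam c = {(r, c'). c' = c \<and> r < length lam \<and> c < lam ! r}"

definition is_tableau :: "nat \<Rightarrow> nat list \<Rightarrow> (nat \<times> nat \<Rightarrow> nat) \<Rightarrow> bool" where
  "is_tableau n lam t \<longleftrightarrow> bij_betw t (cells lam) {0..<n}"

definition row_group :: "nat \<Rightarrow> nat list \<Rightarrow> (nat \<times> nat \<Rightarrow> nat) \<Rightarrow> (nat \<Rightarrow> nat) set" where
  "row_group n lam t = {s \<in> Sym n. \<forall>r. s ` (t ` row_cells lam r) = t ` row_cells lam r}"

definition col_group :: "nat \<Rightarrow> nat list \<Rightarrow> (nat \<times> nat \<Rightarrow> nat) \<Rightarrow> (nat \<Rightarrow> nat) set" where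
  "col_group n lam t = {s \<in> Sym n. \<forall>c. s ` (t ` col_cells lam c) = t ` col_cells lam c}"

definition tabloid :: "nat list \<Rightarrow> (nat \<times> nat \<Rightarrow> nat) \<Rightarrow> nat set list" where
  "tabloid lam t = map (\<lambda>r. t ` row_cells lam r) [0..<length lam]"

text \<open>Action of S_n on M^lam = functions on tabloids: (s . F)(T) = F(s^{-1} T).\<close>
definition tabloid_act :: "(nat \<Rightarrow> nat) \<Rightarrow> (nat set list \<Rightarrow> real) \<Rightarrow> (nat set list \<Rightarrow> real)" where
  "tabloid_act s F = (\<lambda>T. F (map (\<lambda>R. inv s ` R) T))"

definition polytabloid :: "nat \<Rightarrow> nat list \<Rightarrow> (nat \<times> nat \<Rightarrow> nat) \<Rightarrow> (nat set list \<Rightarrow> real)" where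
  "polytabloid n lam t = (\<lambda>T. \<Sum>p\<in>col_group n lam t.
      of_int (sign p) * (if T = tabloid lam (p \<circ> t) then 1 else 0))"

definition Specht :: "nat \<Rightarrow> nat list \<Rightarrow> (nat set list \<Rightarrow> real) set" where
  "Specht n lam = fspan {polytabloid n lam t | t. is_tableau n lam t}"

definition act_invariant_set :: "nat \<Rightarrow> (nat set set \<Rightarrow> real) set \<Rightarrow> bool" where
  "act_invariant_set n U \<longleftrightarrow> (\<forall>s\<in>Sym n. \<forall>f\<in>U. act s f \<in> U)"

definition iso_Specht :: "nat \<Rightarrow> nat list \<Rightarrow> (nat set set \<Rightarrow> real) set \<Rightarrow> bool" where
  "iso_Specht n lam U \<longleftrightarrow> (\<exists>\<phi>. bij_betw \<phi> U (Specht n lam)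
      \<and> (\<forall>f\<in>U. \<forall>g\<in>U. \<phi> (\<lambda>x. f x + g x) = (\<lambda>T. \<phi> f T + \<phi> g T))
      \<and> (\<forall>c. \<forall>f\<in>U. \<phi> (\<lambda>x. c * f x) = (\<lambda>T. c * \<phi> f T))
      \<and> (\<forall>s\<in>Sym n. \<forall>f\<in>U. \<phi> (act s f) = tabloid_act s (\<phi> f)))"

definition isotypic :: "nat \<Rightarrow> nat \<Rightarrow> nat list \<Rightarrow> (nat set set \<Rightarrow> real) set" where
  "isotypic n d lam = fspan (\<Union>{U. U \<subseteq> Vdeg n d \<and> fsubspace U \<and> act_invariant_set n U
                                   \<and> iso_Specht n lam U})"

definition Wtab :: "nat \<Rightarrow> nat \<Rightarrow> nat list \<Rightarrow> (nat \<times> nat \<Rightarrow> nat) \<Rightarrow> (nat set set \<Rightarrow> real) set" where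
  "Wtab n d lam t = {f \<in> isotypic n d lam. \<forall>s\<in>row_group n lam t. act s f = f}"

definition hook :: "nat \<Rightarrow> nat \<Rightarrow> int list" where
  "hook n d = (int n - 2 * int d) # replicate (2 * d) 1"

definition Lambda :: "nat \<Rightarrow> nat \<Rightarrow> nat list set" where
  "Lambda n d = {lam. is_partition n lam \<and>
      (map int lam = hook n d \<or> (hook n d, map int lam) \<in> lexord {(a, b). a < b})}"

definition psd :: "nat \<Rightarrow> (nat \<Rightarrow> nat \<Rightarrow> real) \<Rightarrow> bool" where
  "psd l R \<longleftrightarrow> (\<forall>i<l. \<forall>j<l. R i j = R j i) \<and>
      (\<forall>x. (\<Sum>i<l. \<Sum>j<l. x i * R i j * x j) \<ge> 0)"

end

theory Submission
  imports Defs "HOL-Combinatorics.Cycles" "HOL-Library.Function_Algebras"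
begin

text \<open>For a tableau of shape \<open>\<lambda>\<close> let a be its row symmetrizer and b its column antisymmetrizer in the real
  group algebra, and let \<open>B\<^sub>\<lambda>\<close> be the sum of all conjugates of ba. Dominance of shapes makes the
  central elements \<open>B\<^sub>\<lambda>\<close> pairwise orthogonal; since there are as many of them as conjugacy classes,
  \<open>1 = \<Sum>\<^sub>\<lambda> c\<^sub>\<lambda> B\<^sub>\<lambda>\<close> with all \<open>c\<^sub>\<lambda> > 0\<close>. On the other hand the sum of \<open>(ab\<sigma>)\<^sup>*(ab\<sigma>)\<close> over all
  permutations \<open>\<sigma>\<close> is a positive multiple of \<open>B\<^sub>\<lambda>\<close>. Hence \<open>sym(f\<^sup>2)\<close> is a nonnegative combination of the
  \<open>sym((ab\<sigma>f)\<^sup>2)\<close>. Each \<open>ab\<sigma>f\<close> is a row-invariant element of the isotypic component, by James's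
  submodule theorem, and vanishes for \<open>\<lambda>\<close> outside \<open>\<Lambda>\<close> because a monomial of degree at most d leaves
  more vertices untouched than the diagram has columns.\<close>

subsection \<open>Group algebra elements of the symmetric group acting on functions\<close>

text \<open>Both orders of the product matter. In ab the left factor a yields row invariance and the
  right factor b kills low degrees; the lift of a polytabloid to the group algebra is ba, so copies
  of Specht modules are reached through ba. Summing over conjugates gives ab and ba the same value,
  and this ties the two together. The star inverts group elements: it fixes a and b, reverses
  products, and is the adjoint for the pairing sym(fg). Hence the product of star and element is a
  conjugate of baab; aa is a multiple of a, and under the conjugation sum one b may be moved round
  to meet the other, so the positive factor is the product of the orders of the row and column
  groups. Positivity of \<open>c\<^sub>\<lambda>\<close>: the coefficients of
  \<open>B\<^sub>\<lambda>\<close> are unchanged by inversion, so a vanishing product means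
  orthogonal coefficient vectors; pairing the expansion of 1 with \<open>B\<^sub>\<mu>\<close>
  leaves n! on one side and \<open>c\<^sub>\<mu>\<close> times a squared norm on the other. The
  expansion of 1 also locates the range of ab: every other \<open>B\<^sub>\<mu>\<close> annihilates
  it, and \<open>B\<^sub>\<lambda>\<close> consists of conjugates of ba.\<close>

lemma Sym_id [simp]: "id \<in> Sym n"
  and Sym_comp [simp]: "s \<in> Sym n \<Longrightarrow> t \<in> Sym n \<Longrightarrow> s \<circ> t \<in> Sym n"
  and Sym_inv [simp]: "s \<in> Sym n \<Longrightarrow> inv s \<in> Sym n"
  by (auto simp: Sym_def permutes_id permutes_compose permutes_inv)

lemma finite_Sym [simp]: "finite (Sym n)"
  by (simp add: Sym_def finite_permutations)

lemma card_Sym: "card (Sym n) = fact n"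
  by (simp add: Sym_def card_permutations)

lemma Sym_bij [simp]: "s \<in> Sym n \<Longrightarrow> bij s"
  by (simp add: Sym_def permutes_bij)

lemma Sym_permutation: "s \<in> Sym n \<Longrightarrow> permutation s"
  by (auto simp: Sym_def permutation_permutes)

lemmas bij_simps [simp] = bij_imp_bij_inv bij_comp inv_inv_eq o_inv_distrib

lemma bij_cancel [simp]:
  assumes b: "bij s"
  shows "s \<circ> inv s = id" "inv s \<circ> s = id"
    "s \<circ> (inv s \<circ> f) = f" "inv s \<circ> (s \<circ> f) = f"
    "s (inv s x) = x" "inv s (s x) = x"
proof -
  show 1: "s \<circ> inv s = id" using b by (metis bij_is_surj surj_iff)
  show 2: "inv s \<circ> s = id" using b by (simp add: bij_is_inj)
  show "s \<circ> (inv s \<circ> f) = f" by (simp add: comp_assoc[symmetric] 1)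
  show "inv s \<circ> (s \<circ> f) = f" by (simp add: comp_assoc[symmetric] 2)
  show "s (inv s x) = x" "inv s (s x) = x"
    using 1 2 by (metis comp_apply id_apply)+
qed

lemma Sym_less: "s \<in> Sym n \<Longrightarrow> s x < n \<longleftrightarrow> x < n"
  using permutes_in_image[of s "{0..<n}" x] by (simp add: Sym_def)

lemma Sym_comp_left_iff [simp]: "s \<in> Sym n \<Longrightarrow> s \<circ> t \<in> Sym n \<longleftrightarrow> t \<in> Sym n"
  by (metis bij_cancel(4) Sym_bij Sym_comp Sym_inv)

lemma Sym_comp_right_iff [simp]: 
  assumes s: "s \<in> Sym n" shows "t \<circ> s \<in> Sym n \<longleftrightarrow> t \<in> Sym n"
proof
  assume "t \<circ> s \<in> Sym n"
  from Sym_comp[OF this Sym_inv[OF s]] show "t \<in> Sym n"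
    by (simp only: comp_assoc bij_cancel(1)[OF Sym_bij[OF s]] comp_id)
qed (rule Sym_comp[OF _ s])

lemma transpose_Sym: "i < n \<Longrightarrow> j < n \<Longrightarrow> Transposition.transpose i j \<in> Sym n"
  by (simp add: Sym_def permutes_swap_id)

lemma sum_Sym_left:
  assumes "u \<in> Sym n" shows "(\<Sum>s\<in>Sym n. g (u \<circ> s)) = (\<Sum>s\<in>Sym n. g s)"
  by (rule sum.reindex_bij_witness[of _ "\<lambda>s. inv u \<circ> s" "\<lambda>s. u \<circ> s"]) (use assms in auto)

lemma sum_Sym_right:
  assumes "u \<in> Sym n" shows "(\<Sum>s\<in>Sym n. g (s \<circ> u)) = (\<Sum>s\<in>Sym n. g s)"
  by (rule sum.reindex_bij_witness[of _ "\<lambda>s. s \<circ> inv u" "\<lambda>s. s \<circ> u"])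
    (use assms in \<open>auto simp: comp_assoc\<close>)

lemma sum_Sym_inv: "(\<Sum>s\<in>Sym n. g (inv s)) = (\<Sum>s\<in>Sym n. g s)"
  by (rule sum.reindex_bij_witness[of _ inv inv]) auto

section \<open>Group algebra elements as operators\<close>

locale set_action =
  fixes \<rho> :: "(nat \<Rightarrow> nat) \<Rightarrow> 'x \<Rightarrow> 'x"
  assumes comp: "\<rho> (s \<circ> t) x = \<rho> s (\<rho> t x)"
    and id: "\<rho> id x = x"

text \<open>The operator of the group algebra element with coefficients \<open>\<phi>\<close>.
  Composition is itself an action, so \<open>conv\<close> is the product of the group algebra and
  inherits all linearity lemmas. Coefficients are functions on all maps while only
  \<open>Sym n\<close> is summed over, which is why some identities for \<open>conv\<close> are
  restricted to arguments in \<open>Sym n\<close>.\<close>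

definition gop :: "nat \<Rightarrow> ((nat \<Rightarrow> nat) \<Rightarrow> 'x \<Rightarrow> 'x) \<Rightarrow> ((nat \<Rightarrow> nat) \<Rightarrow> real) \<Rightarrow> ('x \<Rightarrow> real) \<Rightarrow> 'x \<Rightarrow> real" where
  "gop n \<rho> \<phi> f = (\<lambda>x. \<Sum>s\<in>Sym n. \<phi> s * f (\<rho> (inv s) x))"

abbreviation conv :: "nat \<Rightarrow> ((nat \<Rightarrow> nat) \<Rightarrow> real) \<Rightarrow> ((nat \<Rightarrow> nat) \<Rightarrow> real) \<Rightarrow> (nat \<Rightarrow> nat) \<Rightarrow> real" where
  "conv n \<equiv> gop n (\<circ>)"

interpretation reg: set_action "(\<circ>)"
  by standard (auto simp: comp_assoc)

interpretation graph: set_action graph_act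
  by standard (auto simp: graph_act_def image_comp comp_def)

definition tab_act :: "(nat \<Rightarrow> nat) \<Rightarrow> nat set list \<Rightarrow> nat set list" where
  "tab_act s T = map (\<lambda>R. s ` R) T"

interpretation tabl: set_action tab_act
  by standard (auto simp: tab_act_def image_comp)

definition delta :: "(nat \<Rightarrow> nat) \<Rightarrow> (nat \<Rightarrow> nat) \<Rightarrow> real" where
  "delta s t = (if t = s then 1 else 0)"

lemma gop_delta: "s \<in> Sym n \<Longrightarrow> gop n \<rho> (delta s) f = (\<lambda>x. f (\<rho> (inv s) x))"
  by (simp add: gop_def delta_def if_distrib[of "\<lambda>z. z * _"] sum.delta cong: if_cong)

lemma gop_zero [simp]: "gop n \<rho> \<phi> (\<lambda>x. 0) = (\<lambda>x. 0)" "gop n \<rho> (\<lambda>x. 0) f = (\<lambda>x. 0)"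
  by (simp_all add: gop_def)

lemma gop_add_left: "gop n \<rho> (\<lambda>s. \<phi> s + \<psi> s) f = (\<lambda>x. gop n \<rho> \<phi> f x + gop n \<rho> \<psi> f x)"
  by (simp add: gop_def ring_distribs sum.distrib)

lemma gop_scale_left: "gop n \<rho> (\<lambda>s. c * \<phi> s) f = (\<lambda>x. c * gop n \<rho> \<phi> f x)"
  by (simp add: gop_def mult.assoc sum_distrib_left)

lemma gop_sum_left: "gop n \<rho> (\<lambda>s. \<Sum>i\<in>I. \<phi> i s) f = (\<lambda>x. \<Sum>i\<in>I. gop n \<rho> (\<phi> i) f x)"
  unfolding gop_def sum_distrib_right by (rule ext, rule sum.swap)

lemma gop_add_right: "gop n \<rho> \<phi> (\<lambda>x. f x + g x) = (\<lambda>x. gop n \<rho> \<phi> f x + gop n \<rho> \<phi> g x)"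
  by (simp add: gop_def ring_distribs sum.distrib)

lemma gop_scale_right: "gop n \<rho> \<phi> (\<lambda>x. c * f x) = (\<lambda>x. c * gop n \<rho> \<phi> f x)"
  by (simp add: gop_def mult.left_commute sum_distrib_left)

lemma gop_sum_right: "gop n \<rho> \<phi> (\<lambda>x. \<Sum>i\<in>I. f i x) = (\<lambda>x. \<Sum>i\<in>I. gop n \<rho> \<phi> (f i) x)"
  unfolding gop_def sum_distrib_left by (rule ext, rule sum.swap)

lemma gop_cong: "(\<And>s. s \<in> Sym n \<Longrightarrow> \<phi> s = \<psi> s) \<Longrightarrow> gop n \<rho> \<phi> f = gop n \<rho> \<psi> f"
  by (simp add: gop_def)

context set_action
begin

text \<open>Substitute \<open>u = s \<circ> t\<close> in the double sum. For the regular action this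
  is associativity of \<open>conv\<close>, and \<open>reg.gop_gop\<close> is used in that role
  throughout.\<close>

lemma gop_gop: "gop n \<rho> \<phi> (gop n \<rho> \<psi> f) = gop n \<rho> (conv n \<phi> \<psi>) f"
proof
  fix x
  have "gop n \<rho> \<phi> (gop n \<rho> \<psi> f) x
      = (\<Sum>s\<in>Sym n. \<Sum>t\<in>Sym n. \<phi> s * (\<psi> t * f (\<rho> (inv t \<circ> inv s) x)))"
    by (simp add: gop_def comp sum_distrib_left)
  also have "\<dots> = (\<Sum>s\<in>Sym n. \<Sum>u\<in>Sym n. \<phi> s * (\<psi> (inv s \<circ> u) * f (\<rho> (inv u) x)))"
  proof (rule sum.cong[OF refl])
    fix s assume s: "s \<in> Sym n"
    show "(\<Sum>t\<in>Sym n. \<phi> s * (\<psi> t * f (\<rho> (inv t \<circ> inv s) x)))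
        = (\<Sum>u\<in>Sym n. \<phi> s * (\<psi> (inv s \<circ> u) * f (\<rho> (inv u) x)))"
      by (rule sum.reindex_bij_witness[of _ "\<lambda>u. inv s \<circ> u" "\<lambda>t. s \<circ> t"]) (use s in auto)
  qed
  also have "\<dots> = gop n \<rho> (conv n \<phi> \<psi>) f x"
    by (subst sum.swap) (simp add: gop_def sum_distrib_right mult.assoc)
  finally show "gop n \<rho> \<phi> (gop n \<rho> \<psi> f) x = gop n \<rho> (conv n \<phi> \<psi>) f x" .
qed

end

lemma conv_apply: "conv n \<phi> \<psi> x = (\<Sum>s\<in>Sym n. \<phi> s * \<psi> (inv s \<circ> x))"
  by (simp add: gop_def)

lemma conv_apply2:
  assumes "x \<in> Sym n" shows "conv n \<phi> \<psi> x = (\<Sum>s\<in>Sym n. \<phi> (x \<circ> inv s) * \<psi> s)"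
  unfolding conv_apply
  by (rule sum.reindex_bij_witness[of _ "\<lambda>s. x \<circ> inv s" "\<lambda>s. inv s \<circ> x"])
    (use assms in \<open>auto simp: comp_assoc\<close>)

text \<open>The element obtained by adding up all conjugates of \<open>\<phi>\<close>. It is not
  divided by n!, whence the value n! at the identity in \<open>cyoung_id\<close>.\<close>

definition cavg :: "nat \<Rightarrow> ((nat \<Rightarrow> nat) \<Rightarrow> real) \<Rightarrow> (nat \<Rightarrow> nat) \<Rightarrow> real" where
  "cavg n \<phi> x = (\<Sum>t\<in>Sym n. \<phi> (inv t \<circ> (x \<circ> t)))"

lemma cavg_conj:
  assumes "u \<in> Sym n" shows "cavg n \<phi> (u \<circ> (x \<circ> inv u)) = cavg n \<phi> x"
proof -
  have "cavg n \<phi> (u \<circ> (x \<circ> inv u)) = (\<Sum>t\<in>Sym n. \<phi> (inv (inv u \<circ> t) \<circ> (x \<circ> (inv u \<circ> t))))"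
    unfolding cavg_def by (rule sum.cong) (use assms in \<open>auto simp: comp_assoc\<close>)
  also have "\<dots> = cavg n \<phi> x"
    unfolding cavg_def using assms by (intro sum_Sym_left) simp
  finally show ?thesis .
qed

text \<open>Conjugation by \<open>t\<close> and by \<open>t \<circ> s\<close> differ by moving a
  factor s from one end of a product to the other, and all t are summed over. This trace property
  later exchanges ab with ba.\<close>

lemma cavg_conv_comm:
  assumes x: "x \<in> Sym n"
  shows "cavg n (conv n \<phi> \<psi>) x = cavg n (conv n \<psi> \<phi>) x"
proof -
  have "cavg n (conv n \<phi> \<psi>) x
      = (\<Sum>s\<in>Sym n. \<Sum>t\<in>Sym n. \<phi> s * \<psi> (inv s \<circ> (inv t \<circ> (x \<circ> t))))"
    unfolding cavg_def conv_apply by (rule sum.swap)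
  also have "\<dots> = (\<Sum>s\<in>Sym n. \<Sum>t\<in>Sym n. \<phi> s * \<psi> ((inv t \<circ> (x \<circ> t)) \<circ> inv s))"
  proof (rule sum.cong[OF refl])
    fix s assume s: "s \<in> Sym n"
    show "(\<Sum>t\<in>Sym n. \<phi> s * \<psi> (inv s \<circ> (inv t \<circ> (x \<circ> t))))
      = (\<Sum>t\<in>Sym n. \<phi> s * \<psi> ((inv t \<circ> (x \<circ> t)) \<circ> inv s))"
      by (rule sum.reindex_bij_witness[of _ "\<lambda>t. t \<circ> inv s" "\<lambda>t. t \<circ> s"])
        (use s in \<open>auto simp: comp_assoc\<close>)
  qed
  also have "\<dots> = (\<Sum>t\<in>Sym n. \<Sum>s\<in>Sym n. \<psi> ((inv t \<circ> (x \<circ> t)) \<circ> inv s) * \<phi> s)"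
    by (subst sum.swap) (simp add: mult.commute)
  also have "\<dots> = cavg n (conv n \<psi> \<phi>) x"
    unfolding cavg_def by (rule sum.cong[OF refl], subst conv_apply2) (use x in auto)
  finally show ?thesis .
qed

text \<open>Writing each conjugation as multiplication by \<open>delta t\<close> and
  \<open>delta (inv t)\<close> makes associativity applicable to averages.\<close>

lemma (in set_action) gop_cavg:
  "gop n \<rho> (cavg n \<phi>) f = (\<lambda>x. \<Sum>t\<in>Sym n. gop n \<rho> (conv n (delta t) (conv n \<phi> (delta (inv t)))) f x)"
proof -
  have "gop n \<rho> (cavg n \<phi>) f = gop n \<rho> (\<lambda>s. \<Sum>t\<in>Sym n. conv n (delta t) (conv n \<phi> (delta (inv t))) s) f"
  proof (rule gop_cong)
    fix s assume s: "s \<in> Sym n"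
    have "conv n (delta t) (conv n \<phi> (delta (inv t))) s = \<phi> (inv t \<circ> (s \<circ> t))" if t: "t \<in> Sym n" for t
    proof -
      have "conv n (delta t) (conv n \<phi> (delta (inv t))) s = conv n \<phi> (delta (inv t)) (inv t \<circ> s)"
        using t by (simp add: gop_delta)
      also have "\<dots> = (\<Sum>u\<in>Sym n. \<phi> (inv t \<circ> s \<circ> inv u) * delta (inv t) u)"
        using s t by (subst conv_apply2) auto
      also have "\<dots> = \<phi> (inv t \<circ> (s \<circ> t))"
        using t by (simp add: delta_def if_distrib[of "\<lambda>z. _ * z"] sum.delta comp_assoc cong: if_cong)
      finally show ?thesis .
    qed
    then show "cavg n \<phi> s = (\<Sum>t\<in>Sym n. conv n (delta t) (conv n \<phi> (delta (inv t))) s)"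
      by (simp add: cavg_def)
  qed
  then show ?thesis by (simp add: gop_sum_left)
qed

context set_action
begin

lemma gop_cavg':
  "gop n \<rho> (cavg n \<phi>) f = (\<lambda>x. \<Sum>t\<in>Sym n. gop n \<rho> (delta t) (gop n \<rho> \<phi> (gop n \<rho> (delta (inv t)) f)) x)"
  by (simp add: gop_cavg gop_gop)

text \<open>The arbitrary middle factor \<open>y\<close> of the hypothesis absorbs the conjugating
  elements that stand between \<open>\<phi>\<close> and \<open>\<psi>\<close>.\<close>

lemma gop_cavg_cavg_zero:
  assumes "\<And>y. conv n \<phi> (conv n y \<psi>) = (\<lambda>_. 0)"
  shows "gop n \<rho> (cavg n \<phi>) (gop n \<rho> (cavg n \<psi>) f) = (\<lambda>_. 0)"
proof -
  have z: "gop n \<rho> \<phi> (gop n \<rho> y (gop n \<rho> \<psi> g)) = (\<lambda>_. 0)" for y g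
    by (simp add: gop_gop assms)
  have "gop n \<rho> \<phi> (gop n \<rho> y (gop n \<rho> y' (gop n \<rho> \<psi> g))) = (\<lambda>_. 0)" for y y' g
    using z[of "conv n y y'" g] by (simp only: gop_gop[of n y y', symmetric])
  then show ?thesis
    unfolding gop_cavg' gop_sum_right by simp
qed

lemma gop_cavg_zero:
  assumes "\<And>y. conv n \<phi> (conv n y \<psi>) = (\<lambda>_. 0)"
  shows "gop n \<rho> (cavg n \<phi>) (gop n \<rho> \<psi> f) = (\<lambda>_. 0)"
proof -
  have z: "gop n \<rho> \<phi> (gop n \<rho> y (gop n \<rho> \<psi> g)) = (\<lambda>_. 0)" for y g
    by (simp add: gop_gop assms)
  show ?thesis
    unfolding gop_cavg' by (simp add: z)
qed

end

lemma conv_delta_id: "x \<in> Sym n \<Longrightarrow> conv n \<phi> (delta id) x = \<phi> x"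
  by (simp add: conv_apply2 delta_def if_distrib[of "\<lambda>z. _ * z"] sum.delta cong: if_cong)

text \<open>Passing from \<open>\<phi>\<close> to \<open>\<lambda>t. \<phi> (inv t)\<close> is the
  star of the group algebra; it reverses products because inversion does.\<close>

lemma conv_star:
  assumes s: "s \<in> Sym n"
  shows "conv n \<phi> \<psi> (inv s) = conv n (\<lambda>t. \<psi> (inv t)) (\<lambda>t. \<phi> (inv t)) s"
proof -
  have "conv n \<phi> \<psi> (inv s) = (\<Sum>t\<in>Sym n. \<phi> (inv t) * \<psi> (t \<circ> inv s))"
    unfolding conv_apply by (rule sum.reindex_bij_witness[of _ inv inv]) auto
  also have "\<dots> = (\<Sum>t\<in>Sym n. \<psi> (inv (s \<circ> inv t)) * \<phi> (inv t))"
    by (rule sum.cong) (use s in auto)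
  also have "\<dots> = conv n (\<lambda>t. \<psi> (inv t)) (\<lambda>t. \<phi> (inv t)) s"
    using s by (simp add: conv_apply2)
  finally show ?thesis .
qed

lemma conv_inv:
  assumes s: "s \<in> Sym n"
    and "\<And>t. t \<in> Sym n \<Longrightarrow> \<phi> (inv t) = \<phi> t" "\<And>t. t \<in> Sym n \<Longrightarrow> \<psi> (inv t) = \<psi> t"
  shows "conv n \<phi> \<psi> (inv s) = conv n \<psi> \<phi> s"
proof -
  have "\<phi> (inv (inv t \<circ> s)) = \<phi> (inv t \<circ> s)" if "t \<in> Sym n" for t
    using that s by (intro assms(2)) simp
  then show ?thesis
    unfolding conv_star[OF s, of \<phi> \<psi>] conv_apply[of n "\<lambda>t. \<psi> (inv t)"] conv_apply[of n \<psi>]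
    by (simp add: assms(3) del: o_inv_distrib)
qed

text \<open>For self-adjoint factors inversion reverses the product, and the trace property reverses
  it back.\<close>

lemma cavg_conv_inv:
  assumes "s \<in> Sym n"
    and "\<And>t. t \<in> Sym n \<Longrightarrow> \<phi> (inv t) = \<phi> t" "\<And>t. t \<in> Sym n \<Longrightarrow> \<psi> (inv t) = \<psi> t"
  shows "cavg n (conv n \<phi> \<psi>) (inv s) = cavg n (conv n \<phi> \<psi>) s"
proof -
  have "cavg n (conv n \<phi> \<psi>) (inv s) = cavg n (conv n \<psi> \<phi>) s"
    unfolding cavg_def
  proof (rule sum.cong[OF refl])
    fix t assume t: "t \<in> Sym n"
    then show "conv n \<phi> \<psi> (inv t \<circ> (inv s \<circ> t)) = conv n \<psi> \<phi> (inv t \<circ> (s \<circ> t))"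
      using conv_inv[of "inv t \<circ> (s \<circ> t)" n \<phi> \<psi>] assms by (simp add: comp_assoc)
  qed
  then show ?thesis using cavg_conv_comm[OF assms(1)] by simp
qed

text \<open>A subgroup with a character into {1, -1}. The trivial character gives the row
  symmetrizer and the sign gives the column antisymmetrizer, so both share one set of
  lemmas.\<close>

locale twisted =
  fixes n :: nat and H :: "(nat \<Rightarrow> nat) set" and \<epsilon> :: "(nat \<Rightarrow> nat) \<Rightarrow> real"
  assumes sub: "H \<subseteq> Sym n"
    and id_mem: "id \<in> H"
    and comp_mem: "s \<in> H \<Longrightarrow> t \<in> H \<Longrightarrow> s \<circ> t \<in> H"
    and inv_mem: "s \<in> H \<Longrightarrow> inv s \<in> H"
    and eps_comp: "s \<in> H \<Longrightarrow> t \<in> H \<Longrightarrow> \<epsilon> (s \<circ> t) = \<epsilon> s * \<epsilon> t"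
    and eps_sq: "s \<in> H \<Longrightarrow> \<epsilon> s * \<epsilon> s = 1"
begin

definition tw :: "(nat \<Rightarrow> nat) \<Rightarrow> real" where
  "tw s = (if s \<in> H then \<epsilon> s else 0)"

lemma in_Sym [simp]: "s \<in> H \<Longrightarrow> s \<in> Sym n"
  using sub by auto

lemma mem_bij [simp]: "s \<in> H \<Longrightarrow> bij s"
  using in_Sym Sym_bij by blast

lemma eps_inv [simp]: "s \<in> H \<Longrightarrow> \<epsilon> (inv s) = \<epsilon> s"
proof -
  assume s: "s \<in> H"
  have "\<epsilon> s * \<epsilon> (inv s) = \<epsilon> id" using s eps_comp[OF s inv_mem[OF s]] by simp
  also have "\<epsilon> id = 1"
    using eps_comp[OF id_mem id_mem] eps_sq[OF id_mem] by simp
  finally have "\<epsilon> s * \<epsilon> (inv s) = \<epsilon> s * \<epsilon> s" using eps_sq[OF s] by simp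
  moreover have "\<epsilon> s \<noteq> 0" using eps_sq[OF s] by auto
  ultimately show ?thesis by simp
qed

lemma mem_left_iff: "q \<in> H \<Longrightarrow> q \<circ> s \<in> H \<longleftrightarrow> s \<in> H"
  using comp_mem[of "inv q" "q \<circ> s"] comp_mem[of q s] inv_mem[of q] by auto

lemma mem_right_iff: "q \<in> H \<Longrightarrow> s \<circ> q \<in> H \<longleftrightarrow> s \<in> H"
  using comp_mem[of "s \<circ> q" "inv q"] comp_mem[of s q] inv_mem[of q] by (auto simp: comp_assoc)

lemma tw_left: "q \<in> H \<Longrightarrow> tw (q \<circ> s) = \<epsilon> q * tw s"
  by (simp add: tw_def mem_left_iff eps_comp)

lemma tw_right: "q \<in> H \<Longrightarrow> tw (s \<circ> q) = \<epsilon> q * tw s"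
  by (simp add: tw_def mem_right_iff eps_comp)

lemma tw_inv: "s \<in> Sym n \<Longrightarrow> tw (inv s) = tw s"
  using inv_mem[of s] inv_mem[of "inv s"] by (auto simp: tw_def)

text \<open>Translating by an element of \<open>H\<close> costs its sign, and each sign meets
  itself, so all \<open>card H\<close> terms agree.\<close>

lemma tw_tw: "conv n tw tw = (\<lambda>s. real (card H) * tw s)"
proof
  fix x
  have "conv n tw tw x = (\<Sum>s\<in>Sym n. if s \<in> H then tw x else 0)"
    unfolding conv_apply
  proof (rule sum.cong[OF refl])
    fix s assume "s \<in> Sym n"
    show "tw s * tw (inv s \<circ> x) = (if s \<in> H then tw x else 0)"
    proof (cases "s \<in> H")
      case True
      then have "tw s * tw (inv s \<circ> x) = (\<epsilon> s * \<epsilon> s) * tw x"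
        using tw_left[OF inv_mem[OF True], of x] by (simp add: tw_def)
      then show ?thesis using True eps_sq[OF True] by simp
    qed (simp add: tw_def)
  qed
  also have "\<dots> = real (card H) * tw x"
    using sub by (simp add: sum.inter_restrict[symmetric] Int_absorb1)
  finally show "conv n tw tw x = real (card H) * tw x" .
qed

end

text \<open>For each middle element \<open>x\<close>, replacing the summation variable
  \<open>s\<close> by \<open>s \<circ> q\<close> multiplies the inner sum by the product of the two
  signs, which is -1; hence the sum equals its own negative.\<close>

lemma tw_conv_zero:
  assumes "twisted n H \<epsilon>" "twisted n K \<psi>"
    and ex: "\<And>x. x \<in> Sym n \<Longrightarrow> \<exists>q\<in>H. inv x \<circ> (q \<circ> x) \<in> K \<and> \<epsilon> q * \<psi> (inv x \<circ> (q \<circ> x)) = -1"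
  shows "conv n (twisted.tw H \<epsilon>) (conv n y (twisted.tw K \<psi>)) = (\<lambda>_. 0)"
proof
  interpret h: twisted n H \<epsilon> by fact
  interpret k: twisted n K \<psi> by fact
  fix z
  have *: "(\<Sum>s\<in>Sym n. h.tw s * k.tw (inv x \<circ> (inv s \<circ> z))) = 0" (is "?S = 0") if x: "x \<in> Sym n" for x
  proof -
    obtain q where q: "q \<in> H" "inv x \<circ> (q \<circ> x) \<in> K" "\<epsilon> q * \<psi> (inv x \<circ> (q \<circ> x)) = -1"
      using ex[OF x] by blast
    have "?S = (\<Sum>s\<in>Sym n. h.tw (s \<circ> q) * k.tw (inv x \<circ> (inv (s \<circ> q) \<circ> z)))"
      by (rule sum_Sym_right[symmetric]) (use q in simp)
    also have "\<dots> = (\<Sum>s\<in>Sym n. - (h.tw s * k.tw (inv x \<circ> (inv s \<circ> z))))"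
    proof (rule sum.cong[OF refl])
      fix s assume s: "s \<in> Sym n"
      have e: "inv x \<circ> (inv (s \<circ> q) \<circ> z) = inv (inv x \<circ> (q \<circ> x)) \<circ> (inv x \<circ> (inv s \<circ> z))"
        using x s h.in_Sym[OF q(1)] by (simp add: comp_assoc)
      have "h.tw (s \<circ> q) * k.tw (inv x \<circ> (inv (s \<circ> q) \<circ> z))
          = (\<epsilon> q * \<psi> (inv x \<circ> (q \<circ> x))) * (h.tw s * k.tw (inv x \<circ> (inv s \<circ> z)))"
        unfolding e by (simp add: h.tw_right[OF q(1)] k.tw_left[OF k.inv_mem[OF q(2)]] k.eps_inv[OF q(2)])
      then show "h.tw (s \<circ> q) * k.tw (inv x \<circ> (inv (s \<circ> q) \<circ> z)) = - (h.tw s * k.tw (inv x \<circ> (inv s \<circ> z)))"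
        using q(3) by simp
    qed
    finally show ?thesis by (simp add: sum_negf)
  qed
  have "conv n h.tw (conv n y k.tw) z
      = (\<Sum>s\<in>Sym n. \<Sum>x\<in>Sym n. y x * (h.tw s * k.tw (inv x \<circ> (inv s \<circ> z))))"
    by (simp add: conv_apply sum_distrib_left mult_ac)
  also have "\<dots> = (\<Sum>x\<in>Sym n. y x * (\<Sum>s\<in>Sym n. h.tw s * k.tw (inv x \<circ> (inv s \<circ> z))))"
    by (subst sum.swap) (simp add: sum_distrib_left)
  also have "\<dots> = 0" by (simp add: *)
  finally show "conv n h.tw (conv n y k.tw) z = 0" .
qed

text \<open>The left sum absorbs \<open>p\<close> and the right sum absorbs \<open>q\<close>, each
  at the cost of a sign.\<close>

lemma tw_delta_tw:
  assumes "twisted n H \<epsilon>" "twisted n K \<psi>" and p: "p \<in> H" and q: "q \<in> K"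
  shows "conv n (twisted.tw H \<epsilon>) (conv n (delta (p \<circ> q)) (twisted.tw K \<psi>))
    = (\<lambda>x. \<epsilon> p * \<psi> q * conv n (twisted.tw H \<epsilon>) (twisted.tw K \<psi>) x)"
proof
  interpret h: twisted n H \<epsilon> by fact
  interpret k: twisted n K \<psi> by fact
  fix x
  have pq: "p \<in> Sym n" "q \<in> Sym n" using p q by simp_all
  have "conv n h.tw (conv n (delta (p \<circ> q)) k.tw) x
      = (\<Sum>s\<in>Sym n. h.tw s * (\<psi> q * k.tw (inv p \<circ> (inv s \<circ> x))))"
    using pq k.tw_left[OF k.inv_mem[OF q]]
    by (simp add: gop_delta conv_apply q comp_assoc)
  also have "\<dots> = (\<Sum>s\<in>Sym n. h.tw (s \<circ> inv p) * (\<psi> q * k.tw (inv p \<circ> (inv (s \<circ> inv p) \<circ> x))))"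
    by (rule sum_Sym_right[symmetric]) (use pq in simp)
  also have "\<dots> = (\<Sum>s\<in>Sym n. \<epsilon> p * \<psi> q * (h.tw s * k.tw (inv s \<circ> x)))"
    by (rule sum.cong[OF refl]) (use pq p in \<open>simp add: h.tw_right[OF h.inv_mem[OF p]] comp_assoc\<close>)
  also have "\<dots> = \<epsilon> p * \<psi> q * conv n h.tw k.tw x"
    by (simp add: conv_apply sum_distrib_left)
  finally show "conv n h.tw (conv n (delta (p \<circ> q)) k.tw) x = \<epsilon> p * \<psi> q * conv n h.tw k.tw x" .
qed

text \<open>The same sign reversal, with the function \<open>f\<close> itself absorbing
  \<open>q\<close>.\<close>

lemma (in set_action) gop_tw_zero:
  assumes "twisted n K \<psi>" and q: "q \<in> K" "\<psi> q = -1" and f: "\<And>x. f (\<rho> (inv q) x) = f x"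
  shows "gop n \<rho> (twisted.tw K \<psi>) f = (\<lambda>_. 0)"
proof
  interpret k: twisted n K \<psi> by fact
  fix x
  have "gop n \<rho> k.tw f x = (\<Sum>s\<in>Sym n. k.tw (s \<circ> q) * f (\<rho> (inv (s \<circ> q)) x))"
    unfolding gop_def by (rule sum_Sym_right[symmetric]) (use q in simp)
  also have "\<dots> = (\<Sum>s\<in>Sym n. - (k.tw s * f (\<rho> (inv s) x)))"
    by (rule sum.cong[OF refl]) (use k.in_Sym[OF q(1)] q in \<open>simp add: k.tw_right[OF q(1)] comp f\<close>)
  finally show "gop n \<rho> k.tw f x = 0"
    by (simp add: gop_def sum_negf)
qed

text \<open>The trace property brings the two copies of the subgroup sum next to each other, where
  \<open>tw_tw\<close> merges them.\<close>

lemma cavg_tw_mult: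
  assumes "twisted n H \<epsilon>" and x: "x \<in> Sym n"
  shows "cavg n (conv n (twisted.tw H \<epsilon>) (conv n \<phi> (twisted.tw H \<epsilon>))) x
     = real (card H) * cavg n (conv n \<phi> (twisted.tw H \<epsilon>)) x"
proof -
  interpret h: twisted n H \<epsilon> by fact
  have "conv n (conv n \<phi> h.tw) h.tw = conv n \<phi> (conv n h.tw h.tw)"
    by (simp only: reg.gop_gop)
  also have "\<dots> = (\<lambda>s. real (card H) * conv n \<phi> h.tw s)"
    by (simp only: h.tw_tw gop_scale_right)
  finally show ?thesis
    unfolding cavg_conv_comm[OF x, of h.tw] by (simp only: cavg_def sum_distrib_left)
qed

subsection \<open>Tableaux\<close>

definition rowof :: "nat list \<Rightarrow> (nat \<times> nat \<Rightarrow> nat) \<Rightarrow> nat \<Rightarrow> nat" where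
  "rowof lam t x = fst (inv_into (cells lam) t x)"

definition colof :: "nat list \<Rightarrow> (nat \<times> nat \<Rightarrow> nat) \<Rightarrow> nat \<Rightarrow> nat" where
  "colof lam t x = snd (inv_into (cells lam) t x)"

lemma tableau_cell:
  assumes "is_tableau n lam t" "x < n"
  shows "(rowof lam t x, colof lam t x) \<in> cells lam" "t (rowof lam t x, colof lam t x) = x"
proof -
  have x: "x \<in> t ` cells lam"
    using assms bij_betw_imp_surj_on[of t "cells lam" "{0..<n}"] by (simp add: is_tableau_def)
  then show "(rowof lam t x, colof lam t x) \<in> cells lam" "t (rowof lam t x, colof lam t x) = x"
    by (simp_all add: rowof_def colof_def inv_into_into f_inv_into_f)
qed

lemma tableau_entry:
  assumes "is_tableau n lam t" "c \<in> cells lam"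
  shows "t c < n" "rowof lam t (t c) = fst c" "colof lam t (t c) = snd c"
  using assms bij_betwE[of t "cells lam" "{0..<n}"]
  by (auto simp: is_tableau_def rowof_def colof_def inv_into_f_f dest: bij_betw_imp_inj_on)

lemma tableau_eqI:
  assumes "is_tableau n lam t" "x < n" "y < n" "rowof lam t x = rowof lam t y" "colof lam t x = colof lam t y"
  shows "x = y"
  using tableau_cell[OF assms(1)] assms(2-) by metis

lemma tableau_row_image:
  assumes "is_tableau n lam t"
  shows "t ` row_cells lam r = {x. x < n \<and> rowof lam t x = r}"
proof (intro equalityI subsetI)
  fix x assume "x \<in> t ` row_cells lam r"
  then obtain c where "x = t c" "c \<in> cells lam" "fst c = r"
    by (auto simp: row_cells_def cells_def)
  then show "x \<in> {x. x < n \<and> rowof lam t x = r}" using tableau_entry[OF assms] by simp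
next
  fix x assume "x \<in> {x. x < n \<and> rowof lam t x = r}"
  then show "x \<in> t ` row_cells lam r"
    using tableau_cell[OF assms, of x]
    by (intro image_eqI[of _ _ "(rowof lam t x, colof lam t x)"]) (auto simp: row_cells_def cells_def)
qed

lemma tableau_col_image:
  assumes "is_tableau n lam t"
  shows "t ` col_cells lam r = {x. x < n \<and> colof lam t x = r}"
proof (intro equalityI subsetI)
  fix x assume "x \<in> t ` col_cells lam r"
  then obtain c where "x = t c" "c \<in> cells lam" "snd c = r"
    by (auto simp: col_cells_def cells_def)
  then show "x \<in> {x. x < n \<and> colof lam t x = r}" using tableau_entry[OF assms] by simp
next
  fix x assume "x \<in> {x. x < n \<and> colof lam t x = r}"
  then show "x \<in> t ` col_cells lam r"
    using tableau_cell[OF assms, of x]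
    by (intro image_eqI[of _ _ "(rowof lam t x, colof lam t x)"]) (auto simp: col_cells_def cells_def)
qed

text \<open>A permutation that maps each finite fibre into itself is onto it by injectivity. This
  replaces the setwise definitions of row and column groups by pointwise equations.\<close>

lemma Sym_fibres:
  assumes "s \<in> Sym n"
  shows "(\<forall>r. s ` {x. x < n \<and> f x = r} = {x. x < n \<and> f x = r}) \<longleftrightarrow> (\<forall>x<n. f (s x) = f x)"
proof
  assume "\<forall>r. s ` {x. x < n \<and> f x = r} = {x. x < n \<and> f x = r}"
  then have *: "s ` {x. x < n \<and> f x = r} \<subseteq> {x. x < n \<and> f x = r}" for r by blast
  show "\<forall>x<n. f (s x) = f x"
    using * by blast
next
  assume *: "\<forall>x<n. f (s x) = f x"
  show "\<forall>r. s ` {x. x < n \<and> f x = r} = {x. x < n \<and> f x = r}"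
  proof
    fix r
    have "s ` {x. x < n \<and> f x = r} \<subseteq> {x. x < n \<and> f x = r}"
      using * Sym_less[OF assms] by auto
    moreover have "inj_on s {x. x < n \<and> f x = r}"
      using Sym_bij[OF assms] by (auto simp: bij_def intro: inj_on_subset)
    ultimately show "s ` {x. x < n \<and> f x = r} = {x. x < n \<and> f x = r}"
      by (intro endo_inj_surj) auto
  qed
qed

lemma row_group_iff:
  "is_tableau n lam t \<Longrightarrow> s \<in> row_group n lam t \<longleftrightarrow> s \<in> Sym n \<and> (\<forall>x<n. rowof lam t (s x) = rowof lam t x)"
  using Sym_fibres[of s n "rowof lam t"] by (auto simp: row_group_def tableau_row_image)

lemma col_group_iff:
  "is_tableau n lam t \<Longrightarrow> s \<in> col_group n lam t \<longleftrightarrow> s \<in> Sym n \<and> (\<forall>x<n. colof lam t (s x) = colof lam t x)"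
  using Sym_fibres[of s n "colof lam t"] by (auto simp: col_group_def tableau_col_image)

lemma tableau_comp:
  assumes "is_tableau n lam t" "s \<in> Sym n"
  shows "is_tableau n lam (s \<circ> t)"
  using assms bij_betw_trans[of t "cells lam" "{0..<n}" s "{0..<n}"]
  by (simp add: is_tableau_def Sym_def permutes_imp_bij)

lemma tableau_comp_pos:
  assumes "is_tableau n lam t" "s \<in> Sym n" "x < n"
  shows "rowof lam (s \<circ> t) x = rowof lam t (inv s x)" "colof lam (s \<circ> t) x = colof lam t (inv s x)"
proof -
  define c where "c = (rowof lam t (inv s x), colof lam t (inv s x))"
  have c: "c \<in> cells lam" "t c = inv s x"
    using tableau_cell[OF assms(1), of "inv s x"] assms(2,3) by (auto simp: c_def Sym_less)
  then have "(s \<circ> t) c = x" using assms(2) by simp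
  then show "rowof lam (s \<circ> t) x = rowof lam t (inv s x)" "colof lam (s \<circ> t) x = colof lam t (inv s x)"
    using tableau_entry(2,3)[OF tableau_comp[OF assms(1,2)] c(1)] by (simp_all add: c_def)
qed

lemma tabloid_eq_iff:
  assumes "is_tableau n lam t" "is_tableau n lam t'"
  shows "tabloid lam t = tabloid lam t' \<longleftrightarrow> (\<forall>x<n. rowof lam t x = rowof lam t' x)"
proof
  assume "tabloid lam t = tabloid lam t'"
  then have *: "r < length lam \<Longrightarrow> t ` row_cells lam r = t' ` row_cells lam r" for r
    unfolding tabloid_def by simp
  show "\<forall>x<n. rowof lam t x = rowof lam t' x"
  proof (intro allI impI)
    fix x assume x: "x < n"
    have "rowof lam t x < length lam"
      using tableau_cell(1)[OF assms(1) x] by (simp add: cells_def)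
    from *[OF this] have "x \<in> {y. y < n \<and> rowof lam t' y = rowof lam t x}"
      unfolding tableau_row_image[OF assms(1)] tableau_row_image[OF assms(2)] using x by blast
    then show "rowof lam t x = rowof lam t' x" by simp
  qed
next
  assume "\<forall>x<n. rowof lam t x = rowof lam t' x"
  then show "tabloid lam t = tabloid lam t'"
    unfolding tabloid_def by (auto simp: tableau_row_image[OF assms(1)] tableau_row_image[OF assms(2)])
qed

text \<open>A tableau is a total function on pairs, and \<open>tableau_perm\<close> yields agreement
  on the cells only; values elsewhere must be seen to be immaterial.\<close>

lemma tableau_cong:
  assumes "\<And>c. c \<in> cells lam \<Longrightarrow> t c = t' c"
  shows "is_tableau n lam t = is_tableau n lam t'" "tabloid lam t = tabloid lam t'"
    "col_group n lam t = col_group n lam t'"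
proof -
  show "is_tableau n lam t = is_tableau n lam t'"
    unfolding is_tableau_def by (rule bij_betw_cong) (rule assms)
  have r: "t ` row_cells lam r = t' ` row_cells lam r" for r
    by (rule image_cong[OF refl]) (auto intro!: assms simp: row_cells_def cells_def)
  then show "tabloid lam t = tabloid lam t'" by (simp add: tabloid_def)
  have c: "t ` col_cells lam r = t' ` col_cells lam r" for r
    by (rule image_cong[OF refl]) (auto intro!: assms simp: col_cells_def cells_def)
  then show "col_group n lam t = col_group n lam t'" by (simp add: col_group_def)
qed

text \<open>Transitivity of the symmetric group on tableaux of one shape: the relabelling from
  \<open>t\<close> to \<open>t'\<close>, extended by the identity beyond n so that it lies in
  \<open>Sym n\<close>.\<close>

lemma tableau_perm:
  assumes "is_tableau n lam t" "is_tableau n lam t'"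
  obtains s where "s \<in> Sym n" "\<And>c. c \<in> cells lam \<Longrightarrow> s (t c) = t' c"
proof -
  define s where "s x = (if x < n then t' (inv_into (cells lam) t x) else x)" for x
  have "bij_betw (\<lambda>x. t' (inv_into (cells lam) t x)) {0..<n} {0..<n}"
    using bij_betw_trans[OF bij_betw_inv_into[of t "cells lam" "{0..<n}"], of t' "{0..<n}"] assms
    by (simp add: is_tableau_def comp_def)
  then have "bij_betw s {0..<n} {0..<n}"
    by (rule bij_betw_cong[THEN iffD1, rotated]) (simp add: s_def)
  then have "s \<in> Sym n"
    unfolding Sym_def by (auto intro!: bij_imp_permutes simp: s_def)
  moreover have "s (t c) = t' c" if "c \<in> cells lam" for c
    using that assms tableau_entry(1)[OF assms(1) that]
    by (simp add: s_def inv_into_f_f is_tableau_def bij_betw_imp_inj_on)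
  ultimately show ?thesis using that by blast
qed

lemma finite_cells [simp]: "finite (cells lam)"
proof -
  have "cells lam = (SIGMA r:{..<length lam}. {..<lam ! r})" by (auto simp: cells_def)
  then show ?thesis by simp
qed

lemma tableau_card: "is_tableau n lam t \<Longrightarrow> card (cells lam) = n"
  by (auto simp: is_tableau_def dest: bij_betw_same_card)

lemma partition_mono:
  assumes "is_partition n lam" "r \<le> r'" "r' < length lam"
  shows "lam ! r' \<le> lam ! r"
  using sorted_rev_nth_mono[of lam r r'] assms by (simp add: is_partition_def)

lemma partition_col_lt: "is_partition n lam \<Longrightarrow> (r, c) \<in> cells lam \<Longrightarrow> c < n"
  using member_le_sum_list[of "lam ! r" lam] by (auto simp: is_partition_def cells_def)

section \<open>Column heights and the dominance order\<close>

definition height :: "nat list \<Rightarrow> nat \<Rightarrow> nat" where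
  "height lam c = card {r. (r, c) \<in> cells lam}"

text \<open>Since the parts decrease weakly, a column is closed under going up, hence an initial
  segment of rows.\<close>

lemma col_cells_height:
  assumes "is_partition n lam"
  shows "{r. (r, c) \<in> cells lam} = {..<height lam c}"
proof -
  let ?A = "{r. (r, c) \<in> cells lam}"
  have fin: "finite ?A" by (rule finite_subset[of _ "{..<length lam}"]) (auto simp: cells_def)
  have down: "r' \<in> ?A" if "r \<in> ?A" "r' \<le> r" for r r'
    using that partition_mono[OF assms, of r' r] by (auto simp: cells_def)
  show ?thesis
  proof (cases "?A = {}")
    case True then show ?thesis unfolding height_def by (simp only: card.empty) simp
  next
    case False
    have "?A = {..Max ?A}"
    proof (intro equalityI subsetI)
      fix r assume "r \<in> {..Max ?A}"
      then show "r \<in> ?A" using down[OF Max_in[OF fin False]] by blast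
    qed (use Max_ge[OF fin] in blast)
    then show ?thesis unfolding height_def by (metis card_atMost lessThan_Suc_atMost)
  qed
qed

lemma cells_height: "is_partition n lam \<Longrightarrow> (r, c) \<in> cells lam \<longleftrightarrow> r < height lam c"
  using col_cells_height[of n lam c] by blast

lemma card_fibres:
  assumes "finite A" "\<And>x. x \<in> A \<Longrightarrow> f x < (m::nat)"
  shows "card A = (\<Sum>c<m. card {x\<in>A. f x = c})"
proof -
  have "A = (\<Union>c<m. {x\<in>A. f x = c})" using assms(2) by auto
  then have "card A = card (\<Union>c<m. {x\<in>A. f x = c})" by simp
  also have "\<dots> = (\<Sum>c<m. card {x\<in>A. f x = c})"
    by (rule card_UN_disjoint) (use assms(1) in auto)
  finally show ?thesis .
qed

lemma card_rows_lt:
  assumes "is_tableau n lam t"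
  shows "card {x. x < n \<and> rowof lam t x < k} = card {c\<in>cells lam. fst c < k}"
proof -
  have "bij_betw t {c\<in>cells lam. fst c < k} {x. x < n \<and> rowof lam t x < k}"
  proof (rule bij_betw_imageI)
    show "inj_on t {c \<in> cells lam. fst c < k}"
      using assms by (auto simp: is_tableau_def bij_betw_def intro: inj_on_subset)
    show "t ` {c \<in> cells lam. fst c < k} = {x. x < n \<and> rowof lam t x < k}"
    proof (intro equalityI subsetI)
      fix x assume "x \<in> {x. x < n \<and> rowof lam t x < k}"
      then show "x \<in> t ` {c \<in> cells lam. fst c < k}"
        using tableau_cell[OF assms, of x]
        by (intro image_eqI[of _ _ "(rowof lam t x, colof lam t x)"]) auto
    qed (use tableau_entry[OF assms] in auto)
  qed
  then show ?thesis by (rule bij_betw_same_card[symmetric])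
qed

text \<open>Counting the first \<open>k\<close> rows column by column; the range \<open>c<n\<close>
  suffices because every column index of the diagram is below n.\<close>

lemma card_cells_rows_lt:
  assumes "is_partition n mu"
  shows "card {c\<in>cells mu. fst c < k} = (\<Sum>c<n. min k (height mu c))"
proof -
  have "card {c\<in>cells mu. fst c < k} = (\<Sum>c<n. card {x \<in> {c\<in>cells mu. fst c < k}. snd x = c})"
    by (rule card_fibres) (use partition_col_lt[OF assms] in auto)
  also have "\<dots> = (\<Sum>c<n. min k (height mu c))"
  proof (rule sum.cong[OF refl])
    fix c
    have "{x \<in> {c\<in>cells mu. fst c < k}. snd x = c} = (\<lambda>r. (r, c)) ` {..<min k (height mu c)}"
      using cells_height[OF assms] by auto
    then show "card {x \<in> {c\<in>cells mu. fst c < k}. snd x = c} = min k (height mu c)"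
      by (simp add: card_image inj_on_def)
  qed
  finally show ?thesis .
qed

text \<open>The hypothesis of the dominance lemma: no two distinct entries share both a row of
  \<open>s\<close> and a column of \<open>t\<close>. A clashing pair supplies the transposition that
  makes a product of symmetrizers vanish.\<close>

definition noclash :: "nat \<Rightarrow> nat list \<Rightarrow> (nat \<times> nat \<Rightarrow> nat) \<Rightarrow> nat list \<Rightarrow> (nat \<times> nat \<Rightarrow> nat) \<Rightarrow> bool" where
  "noclash n lam s mu t \<longleftrightarrow>
     (\<forall>x<n. \<forall>y<n. rowof lam s x = rowof lam s y \<longrightarrow> colof mu t x = colof mu t y \<longrightarrow> x = y)"

text \<open>Within one column of \<open>t\<close> the entries lie in distinct rows of
  \<open>s\<close>, which bounds their number by \<open>k\<close>, and in distinct cells of that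
  column, which bounds it by the height.\<close>

lemma noclash_card_le:
  assumes "is_partition n mu" "is_tableau n mu t" "noclash n lam s mu t"
  shows "card {x. x < n \<and> rowof lam s x < k \<and> colof mu t x = c} \<le> min k (height mu c)"
proof -
  let ?X = "{x. x < n \<and> rowof lam s x < k \<and> colof mu t x = c}"
  have "card ?X = card (rowof lam s ` ?X)"
    using assms(3) by (intro card_image[symmetric] inj_onI) (auto simp: noclash_def)
  also have "\<dots> \<le> card {..<k}" by (rule card_mono) auto
  finally have 1: "card ?X \<le> k" by simp
  have "card ?X = card (rowof mu t ` ?X)"
    using tableau_eqI[OF assms(2)] by (intro card_image[symmetric] inj_onI) auto
  also have "\<dots> \<le> card {..<height mu c}"
    using cells_height[OF assms(1)] tableau_cell[OF assms(2)]
    by (intro card_mono) auto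
  finally show ?thesis using 1 by simp
qed

lemma noclash_sum:
  assumes "is_partition n mu" "is_tableau n mu t" "is_tableau n lam s"
  shows "card {c\<in>cells lam. fst c < k}
     = (\<Sum>c<n. card {x. x < n \<and> rowof lam s x < k \<and> colof mu t x = c})"
proof -
  have "card {c\<in>cells lam. fst c < k} = card {x. x < n \<and> rowof lam s x < k}"
    using card_rows_lt[OF assms(3)] by simp
  also have "\<dots> = (\<Sum>c<n. card {x \<in> {x. x < n \<and> rowof lam s x < k}. colof mu t x = c})"
    by (rule card_fibres) (use tableau_cell(1)[OF assms(2)] partition_col_lt[OF assms(1)] in auto)
  finally show ?thesis by (simp add: conj_assoc)
qed

text \<open>The column-wise bounds add up to the number of cells in the first \<open>k\<close> rows
  of \<open>mu\<close>.\<close>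

lemma noclash_dominance:
  assumes "is_partition n mu" "is_tableau n mu t" "is_tableau n lam s" "noclash n lam s mu t"
  shows "card {c\<in>cells lam. fst c < k} \<le> card {c\<in>cells mu. fst c < k}"
  unfolding noclash_sum[OF assms(1-3)] card_cells_rows_lt[OF assms(1)]
  by (rule sum_mono) (rule noclash_card_le[OF assms(1,2,4)])

lemma partition_eqI:
  assumes "is_partition n lam" "is_partition n mu"
    and eq: "\<And>k. card {c\<in>cells lam. fst c < k} = card {c\<in>cells mu. fst c < k}"
  shows "lam = mu"
proof -
  \<comment> \<open>Padding by 0 allows shapes of different lengths; as the parts of a partition are
    positive, the padded sequence still determines the length.\<close>
  define part where "part l r = (if r < length l then l ! r else 0)" for l :: "nat list" and r
  have step: "card {c\<in>cells l. fst c < Suc r} = card {c\<in>cells l. fst c < r} + part l r" for l r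
  proof -
    have "{c\<in>cells l. fst c < Suc r} = {c\<in>cells l. fst c < r} \<union> (\<lambda>c. (r, c)) ` {..<part l r}"
      by (auto simp: cells_def part_def less_Suc_eq split: if_splits)
    also have "card \<dots> = card {c\<in>cells l. fst c < r} + card ((\<lambda>c. (r, c)) ` {..<part l r})"
      by (rule card_Un_disjoint) auto
    finally show ?thesis by (simp add: card_image inj_on_def)
  qed
  have p: "part lam r = part mu r" for r
    using step[of lam r] step[of mu r] eq[of r] eq[of "Suc r"] by simp
  have len: "r < length l \<longleftrightarrow> 0 < part l r" if "is_partition n l" for l r
    using that by (auto simp: part_def is_partition_def)
  have "length lam = length mu"
    using len[OF assms(1)] len[OF assms(2)] p by (metis linorder_neqE_nat less_irrefl)
  then show ?thesis
    using p by (intro nth_equalityI) (auto simp: part_def split: if_splits, metis)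
qed

lemma noclash_antisym:
  assumes "is_partition n lam" "is_partition n mu"
    "is_tableau n lam s" "is_tableau n mu t" "noclash n lam s mu t"
    "is_tableau n lam s'" "is_tableau n mu t'" "noclash n mu t' lam s'"
  shows "lam = mu"
  using noclash_dominance[OF assms(2,4,3,5)] noclash_dominance[OF assms(1,6,7,8)]
  by (intro partition_eqI[OF assms(1,2)] antisym)

text \<open>The equality case of dominance: with equal shapes there is a tableau having the rows of
  \<open>s \<circ> t\<close> and the columns of \<open>t\<close>. A column permutation
  \<open>p\<close> carries \<open>t\<close> to it, and what remains of \<open>s\<close> preserves
  the rows of \<open>t\<close>.\<close>

lemma noclash_factor:
  assumes lam: "is_partition n lam" and t: "is_tableau n lam t" and s: "s \<in> Sym n"
    and nc: "noclash n lam (s \<circ> t) lam t"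
  shows "\<exists>p\<in>col_group n lam t. \<exists>q\<in>row_group n lam t. s = p \<circ> q"
proof -
  note st = tableau_comp[OF t s]
  let ?r = "rowof lam (s \<circ> t)" and ?c = "colof lam t"
  have r_lt: "?r x < height lam (?c x)" if x: "x < n" for x
  proof -
    define c where "c = ?c x"
    define k where "k = height lam c"
    have "c < n" using tableau_cell(1)[OF t x] partition_col_lt[OF lam] by (simp add: c_def)
    have le: "card {x. x < n \<and> ?r x < k \<and> ?c x = c} \<le> min k (height lam c)" for c
      by (rule noclash_card_le[OF lam t nc])
    \<comment> \<open>Both sides count the first \<open>k\<close> rows of the same shape, so each
      termwise inequality is an equality. For \<open>k\<close> the height of the column, all its
      entries then lie in the first \<open>k\<close> rows of \<open>s \<circ> t\<close>.\<close>
    have "(\<Sum>c<n. card {x. x < n \<and> ?r x < k \<and> ?c x = c}) = (\<Sum>c<n. min k (height lam c))"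
      using noclash_sum[OF lam t st, of k] card_cells_rows_lt[OF lam, of k] by simp
    then have "card {x. x < n \<and> ?r x < k \<and> ?c x = c} = min k (height lam c)"
      using sum_mono_inv[of "\<lambda>c. card {x. x < n \<and> ?r x < k \<and> ?c x = c}" "{..<n}"
          "\<lambda>c. min k (height lam c)" c] le \<open>c < n\<close> by simp
    also have "\<dots> = k" by (simp add: k_def)
    finally have 1: "card {x. x < n \<and> ?r x < k \<and> ?c x = c} = k" .
    have "card {x. x < n \<and> ?c x = c} = card (rowof lam t ` {x. x < n \<and> ?c x = c})"
      using tableau_eqI[OF t] by (intro card_image[symmetric] inj_onI) auto
    also have "\<dots> \<le> card {..<k}"
      unfolding k_def using cells_height[OF lam] tableau_cell[OF t]
      by (intro card_mono) auto
    finally have "{x. x < n \<and> ?r x < k \<and> ?c x = c} = {x. x < n \<and> ?c x = c}"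
      using 1 by (intro card_seteq) auto
    then show ?thesis using x by (auto simp: c_def k_def)
  qed
  \<comment> \<open>The cell at which the intermediate tableau must hold \<open>x\<close>. Absence
    of clashes makes \<open>g\<close> injective, and counting makes it bijective onto the
    diagram.\<close>
  define g where "g x = (?r x, ?c x)" for x
  have "inj_on g {0..<n}"
    using nc by (auto simp: g_def inj_on_def noclash_def)
  moreover have "g ` {0..<n} \<subseteq> cells lam"
    using r_lt cells_height[OF lam] by (auto simp: g_def)
  moreover have "card (cells lam) = n" using tableau_card[OF t] .
  ultimately have g: "bij_betw g {0..<n} (cells lam)"
    using card_subset_eq[of "cells lam" "g ` {0..<n}"] by (simp add: bij_betw_def card_image)
  define u where "u = inv_into {0..<n} g"
  have u: "is_tableau n lam u"
    using bij_betw_inv_into[OF g] by (simp add: is_tableau_def u_def)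
  have gu: "g (u c) = c" if "c \<in> cells lam" for c
    using g that by (simp add: u_def bij_betw_inv_into_right)
  obtain p where p: "p \<in> Sym n" "\<And>c. c \<in> cells lam \<Longrightarrow> p (t c) = u c"
    using tableau_perm[OF t u] by blast
  have pc: "?c (p x) = ?c x" and pr: "?r (p x) = rowof lam t x" if x: "x < n" for x
  proof -
    let ?d = "(rowof lam t x, ?c x)"
    note d = tableau_cell[OF t x]
    have "p x = u ?d" using p(2)[OF d(1)] d(2) by simp
    then have "g (p x) = ?d" using gu[OF d(1)] by simp
    then show "?c (p x) = ?c x" "?r (p x) = rowof lam t x" by (simp_all add: g_def)
  qed
  have "p \<in> col_group n lam t" using p(1) pc by (simp add: col_group_iff[OF t])
  moreover have "inv p \<circ> s \<in> row_group n lam t"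
    unfolding row_group_iff[OF t]
  proof (intro conjI allI impI)
    show "inv p \<circ> s \<in> Sym n" using p(1) s by simp
    fix x assume x: "x < n"
    define y where "y = inv p (s x)"
    have y: "y < n" "p y = s x" using x p(1) s by (simp_all add: y_def Sym_less)
    have "rowof lam t y = ?r (s x)" using pr[OF y(1)] y(2) by simp
    also have "\<dots> = rowof lam t x"
      using tableau_comp_pos(1)[OF t s, of "s x"] x s by (simp add: Sym_less)
    finally show "rowof lam t ((inv p \<circ> s) x) = rowof lam t x" by (simp add: y_def)
  qed
  moreover have "s = p \<circ> (inv p \<circ> s)" using p(1) by simp
  ultimately show ?thesis by blast
qed

subsection \<open>Young symmetrizers\<close>

definition rowsym :: "nat \<Rightarrow> nat list \<Rightarrow> (nat \<times> nat \<Rightarrow> nat) \<Rightarrow> (nat \<Rightarrow> nat) \<Rightarrow> real" where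
  "rowsym n lam t = twisted.tw (row_group n lam t) (\<lambda>_. 1)"

definition colsym :: "nat \<Rightarrow> nat list \<Rightarrow> (nat \<times> nat \<Rightarrow> nat) \<Rightarrow> (nat \<Rightarrow> nat) \<Rightarrow> real" where
  "colsym n lam t = twisted.tw (col_group n lam t) (\<lambda>s. of_int (sign s))"

lemma row_group_twisted: "is_tableau n lam t \<Longrightarrow> twisted n (row_group n lam t) (\<lambda>_. 1)"
  by standard (auto simp: row_group_iff Sym_less elim: allE[of _ "inv _ _"],
    metis Sym_bij Sym_inv Sym_less bij_cancel(5))

lemma col_group_twisted: "is_tableau n lam t \<Longrightarrow> twisted n (col_group n lam t) (\<lambda>s. of_int (sign s))"
proof standard
  assume t: "is_tableau n lam t"
  note [simp] = col_group_iff[OF t]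
  show "col_group n lam t \<subseteq> Sym n" "id \<in> col_group n lam t" by auto
  show "s \<circ> u \<in> col_group n lam t" if "s \<in> col_group n lam t" "u \<in> col_group n lam t" for s u
    using that by (auto simp: Sym_less)
  show "inv s \<in> col_group n lam t" if "s \<in> col_group n lam t" for s
    using that by (auto, metis Sym_bij Sym_inv Sym_less bij_cancel(5))
  show "real_of_int (sign (s \<circ> u)) = real_of_int (sign s) * real_of_int (sign u)"
    if "s \<in> col_group n lam t" "u \<in> col_group n lam t" for s u
    using that Sym_permutation[of s n] Sym_permutation[of u n] by (simp add: sign_compose)
  show "real_of_int (sign s) * real_of_int (sign s) = 1" for s
    by (simp flip: of_int_mult)
qed

lemma row_inter_col:
  assumes t: "is_tableau n lam t" and "s \<in> row_group n lam t" "s \<in> col_group n lam t"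
  shows "s = id"
proof
  fix x
  have s: "s \<in> Sym n" using assms by (simp add: row_group_iff)
  show "s x = id x"
  proof (cases "x < n")
    case True
    then show ?thesis
      using tableau_eqI[OF t, of "s x" x] assms s by (simp add: row_group_iff col_group_iff Sym_less)
  next
    case False
    then show ?thesis using s by (simp add: Sym_def permutes_not_in)
  qed
qed

lemma transpose_fibre:
  assumes "i < n" "j < n" "f i = f j"
  shows "\<forall>x<n. f (Transposition.transpose i j x) = f x"
  using assms by (auto simp: Transposition.transpose_def)

lemma transpose_row_group:
  "is_tableau n lam t \<Longrightarrow> i < n \<Longrightarrow> j < n \<Longrightarrow> rowof lam t i = rowof lam t j \<Longrightarrow>
    Transposition.transpose i j \<in> row_group n lam t"
  using transpose_fibre[of i n j "rowof lam t"] by (simp add: row_group_iff transpose_Sym)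

lemma transpose_col_group:
  "is_tableau n lam t \<Longrightarrow> i < n \<Longrightarrow> j < n \<Longrightarrow> colof lam t i = colof lam t j \<Longrightarrow>
    Transposition.transpose i j \<in> col_group n lam t"
  using transpose_fibre[of i n j "colof lam t"] by (simp add: col_group_iff transpose_Sym)

lemma conj_transpose:
  assumes "bij (x :: 'a \<Rightarrow> 'a)"
  shows "inv x \<circ> (Transposition.transpose i j \<circ> x) = Transposition.transpose (inv x i) (inv x j)"
proof
  fix y
  show "(inv x \<circ> (Transposition.transpose i j \<circ> x)) y = Transposition.transpose (inv x i) (inv x j) y"
    unfolding Transposition.transpose_def comp_apply bij_inv_eq_iff[OF assms, of y] by (simp add: assms)
qed

text \<open>A clashing pair gives a transposition in the row group of \<open>s\<close> whose
  conjugate by \<open>x\<close> lies in the column group of \<open>t\<close>; the row sign 1 and the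
  column sign -1 multiply to -1.\<close>

lemma row_col_zero:
  assumes s: "is_tableau n lam s" and t: "is_tableau n mu t"
    and clash: "\<And>x. x \<in> Sym n \<Longrightarrow> \<not> noclash n lam s mu (x \<circ> t)"
  shows "conv n (rowsym n lam s) (conv n y (colsym n mu t)) = (\<lambda>_. 0)"
  unfolding rowsym_def colsym_def
proof (rule tw_conv_zero[OF row_group_twisted[OF s] col_group_twisted[OF t]])
  fix x assume x: "x \<in> Sym n"
  obtain i j where ij: "i < n" "j < n" "i \<noteq> j" "rowof lam s i = rowof lam s j"
    "colof mu (x \<circ> t) i = colof mu (x \<circ> t) j"
    using clash[OF x] by (auto simp: noclash_def)
  let ?q = "Transposition.transpose i j"
  have ne: "inv x i \<noteq> inv x j" using ij(3) x by (metis Sym_bij bij_cancel(5))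
  have "inv x \<circ> (?q \<circ> x) \<in> col_group n mu t"
    using ij x by (simp add: conj_transpose transpose_col_group[OF t] Sym_less tableau_comp_pos[OF t])
  moreover have "sign (inv x \<circ> (?q \<circ> x)) = -1"
    using x ne by (simp add: conj_transpose sign_swap_id)
  ultimately show "\<exists>q\<in>row_group n lam s. inv x \<circ> (q \<circ> x) \<in> col_group n mu t \<and>
      1 * real_of_int (sign (inv x \<circ> (q \<circ> x))) = - 1"
    using transpose_row_group[OF s ij(1,2,4)] by (intro bexI[of _ ?q]) auto
qed

lemma col_row_zero:
  assumes s: "is_tableau n lam s" and t: "is_tableau n mu t"
    and clash: "\<And>x. x \<in> Sym n \<Longrightarrow> \<not> noclash n mu (x \<circ> t) lam s"
  shows "conv n (colsym n lam s) (conv n y (rowsym n mu t)) = (\<lambda>_. 0)"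
  unfolding rowsym_def colsym_def
proof (rule tw_conv_zero[OF col_group_twisted[OF s] row_group_twisted[OF t]])
  fix x assume x: "x \<in> Sym n"
  obtain i j where ij: "i < n" "j < n" "i \<noteq> j" "colof lam s i = colof lam s j"
    "rowof mu (x \<circ> t) i = rowof mu (x \<circ> t) j"
    using clash[OF x] by (auto simp: noclash_def)
  let ?q = "Transposition.transpose i j"
  have "inv x \<circ> (?q \<circ> x) \<in> row_group n mu t"
    using ij x by (simp add: conj_transpose transpose_row_group[OF t] Sym_less tableau_comp_pos[OF t])
  then show "\<exists>q\<in>col_group n lam s. inv x \<circ> (q \<circ> x) \<in> row_group n mu t \<and>
      real_of_int (sign q) * 1 = - 1"
    using transpose_col_group[OF s ij(1,2,4)] ij(3) by (intro bexI[of _ ?q]) (auto simp: sign_swap_id)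
qed

definition young :: "nat \<Rightarrow> nat list \<Rightarrow> (nat \<times> nat \<Rightarrow> nat) \<Rightarrow> (nat \<Rightarrow> nat) \<Rightarrow> real" where
  "young n lam t = conv n (colsym n lam t) (rowsym n lam t)"

text \<open>Clash-free positions in both directions would make the two shapes dominate each
  other.\<close>

lemma clash_dichotomy:
  assumes "is_partition n lam" "is_partition n mu" "is_tableau n lam s" "is_tableau n mu t" "lam \<noteq> mu"
  shows "(\<forall>x\<in>Sym n. \<not> noclash n lam s mu (x \<circ> t)) \<or> (\<forall>x\<in>Sym n. \<not> noclash n mu (x \<circ> t) lam s)"
  using noclash_antisym[OF assms(1,2,3) _ _ assms(3)] tableau_comp[OF assms(4)] assms(5) by blast

text \<open>The product b a y b' a' contains both patterns a..b' and b..a'. Whichever direction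
  always clashes, one of them vanishes; the rest is rebracketing.\<close>

lemma young_conv_young:
  assumes "is_partition n lam" "is_partition n mu" "is_tableau n lam s" "is_tableau n mu t" "lam \<noteq> mu"
  shows "conv n (young n lam s) (conv n y (young n mu t)) = (\<lambda>_. 0)"
proof -
  let ?a = "rowsym n lam s" and ?b = "colsym n lam s" and ?a' = "rowsym n mu t" and ?b' = "colsym n mu t"
  have eq: "conv n (young n lam s) (conv n y (young n mu t)) = conv n ?b (conv n (conv n ?a (conv n y ?b')) ?a')"
    by (simp only: young_def reg.gop_gop)
  from clash_dichotomy[OF assms] show ?thesis
  proof
    assume "\<forall>x\<in>Sym n. \<not> noclash n lam s mu (x \<circ> t)"
    then have "conv n ?a (conv n y ?b') = (\<lambda>_. 0)" by (intro row_col_zero assms) auto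
    then show ?thesis unfolding eq by simp
  next
    assume "\<forall>x\<in>Sym n. \<not> noclash n mu (x \<circ> t) lam s"
    then show ?thesis unfolding eq by (intro col_row_zero assms) auto
  qed
qed

text \<open>Here b a y a' b' again contains a..b' and b..a'. This is what lets the central elements
  of other shapes annihilate \<open>rcop\<close>.\<close>

lemma young_conv_row_col:
  assumes "is_partition n lam" "is_partition n mu" "is_tableau n lam s" "is_tableau n mu t" "lam \<noteq> mu"
  shows "conv n (young n lam s) (conv n y (conv n (rowsym n mu t) (colsym n mu t))) = (\<lambda>_. 0)"
proof -
  let ?a = "rowsym n lam s" and ?b = "colsym n lam s" and ?a' = "rowsym n mu t" and ?b' = "colsym n mu t"
  have eq: "conv n (young n lam s) (conv n y (conv n ?a' ?b')) = conv n ?b (conv n ?a (conv n (conv n y ?a') ?b'))"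
    by (simp only: young_def reg.gop_gop)
  have eq': "conv n (young n lam s) (conv n y (conv n ?a' ?b')) = conv n (conv n ?b (conv n (conv n ?a y) ?a')) ?b'"
    by (simp only: young_def reg.gop_gop)
  from clash_dichotomy[OF assms] show ?thesis
  proof
    assume "\<forall>x\<in>Sym n. \<not> noclash n lam s mu (x \<circ> t)"
    then have "conv n ?a (conv n (conv n y ?a') ?b') = (\<lambda>_. 0)" by (intro row_col_zero assms) auto
    then show ?thesis unfolding eq by simp
  next
    assume "\<forall>x\<in>Sym n. \<not> noclash n mu (x \<circ> t) lam s"
    then have "conv n ?b (conv n (conv n ?a y) ?a') = (\<lambda>_. 0)" by (intro col_row_zero assms) auto
    then show ?thesis unfolding eq' by simp
  qed
qed

definition cyoung :: "nat \<Rightarrow> nat list \<Rightarrow> (nat \<times> nat \<Rightarrow> nat) \<Rightarrow> (nat \<Rightarrow> nat) \<Rightarrow> real" where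
  "cyoung n lam t = cavg n (young n lam t)"

lemma rowsym_inv: "is_tableau n lam t \<Longrightarrow> s \<in> Sym n \<Longrightarrow> rowsym n lam t (inv s) = rowsym n lam t s"
  unfolding rowsym_def by (rule twisted.tw_inv[OF row_group_twisted])

lemma colsym_inv: "is_tableau n lam t \<Longrightarrow> s \<in> Sym n \<Longrightarrow> colsym n lam t (inv s) = colsym n lam t s"
  unfolding colsym_def by (rule twisted.tw_inv[OF col_group_twisted])

lemma cyoung_inv: "is_tableau n lam t \<Longrightarrow> s \<in> Sym n \<Longrightarrow> cyoung n lam t (inv s) = cyoung n lam t s"
  unfolding cyoung_def young_def by (rule cavg_conv_inv) (simp_all add: rowsym_inv colsym_inv)

text \<open>Row and column group meet only in the identity, so the coefficient of the identity in ba
  is 1, and each of the n! conjugates contributes it once.\<close>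

lemma cyoung_id:
  assumes t: "is_tableau n lam t" shows "cyoung n lam t id = fact n"
proof -
  have "young n lam t id = (\<Sum>s\<in>Sym n. if s = id then 1 else 0)"
    unfolding young_def conv_apply
  proof (rule sum.cong[OF refl])
    fix s assume s: "s \<in> Sym n"
    have "colsym n lam t s * rowsym n lam t s = (if s = id then 1 else 0)"
      using row_inter_col[OF t, of s]
      by (auto simp: colsym_def rowsym_def twisted.tw_def[OF row_group_twisted[OF t]]
          twisted.tw_def[OF col_group_twisted[OF t]] twisted.id_mem[OF row_group_twisted[OF t]]
          twisted.id_mem[OF col_group_twisted[OF t]])
    then show "colsym n lam t s * rowsym n lam t (inv s \<circ> id) = (if s = id then 1 else 0)"
      using rowsym_inv[OF t s] by simp
  qed
  then have "young n lam t id = 1" by simp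
  then have "cyoung n lam t id = (\<Sum>s\<in>Sym n. 1)"
    unfolding cyoung_def cavg_def by (intro sum.cong) auto
  then show ?thesis by (simp add: card_Sym)
qed

text \<open>The product of the two central elements is zero. Its coefficient at the identity pairs x
  with its inverse, and \<open>cyoung_inv\<close> turns this into the inner product;
  \<open>delta id\<close> serves as the unit to which both operators are applied.\<close>

lemma cyoung_orthogonal:
  assumes "is_partition n lam" "is_partition n mu" "is_tableau n lam s" "is_tableau n mu t" "lam \<noteq> mu"
  shows "(\<Sum>x\<in>Sym n. cyoung n lam s x * cyoung n mu t x) = 0"
proof -
  have "conv n (cyoung n lam s) (conv n (cyoung n mu t) (delta id)) id = 0"
    unfolding cyoung_def by (subst reg.gop_cavg_cavg_zero[OF young_conv_young[OF assms]]) (rule refl)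
  moreover have "conv n (cyoung n lam s) (conv n (cyoung n mu t) (delta id)) id
      = (\<Sum>x\<in>Sym n. cyoung n lam s x * cyoung n mu t x)"
    unfolding conv_apply[of n "cyoung n lam s"]
    by (rule sum.cong) (simp_all add: conv_delta_id cyoung_inv assms)
  ultimately show ?thesis by simp
qed

subsection \<open>Conjugacy classes and partitions\<close>

text \<open>The rows are the cycles of \<open>s\<close>, each written in the order in which
  \<open>s\<close> runs through it, so the shape is a cycle type.\<close>

definition cyclic_tableau :: "nat \<Rightarrow> nat list \<Rightarrow> (nat \<times> nat \<Rightarrow> nat) \<Rightarrow> (nat \<Rightarrow> nat) \<Rightarrow> bool" where
  "cyclic_tableau n lam t s \<longleftrightarrow> is_tableau n lam t \<and>
     (\<forall>r c. (r, c) \<in> cells lam \<longrightarrow> s (t (r, c)) = t (r, Suc c mod lam ! r))"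

text \<open>The relabelling that takes \<open>t\<close> to \<open>t'\<close> carries the cycles of
  \<open>s\<close> to those of \<open>s'\<close>.\<close>

lemma cyclic_tableau_conj:
  assumes s: "s \<in> Sym n" "s' \<in> Sym n" and t: "cyclic_tableau n lam t s" "cyclic_tableau n lam t' s'"
  shows "\<exists>u\<in>Sym n. s' = u \<circ> (s \<circ> inv u)"
proof -
  have tt: "is_tableau n lam t" "is_tableau n lam t'" using t by (auto simp: cyclic_tableau_def)
  obtain u where u: "u \<in> Sym n" "\<And>c. c \<in> cells lam \<Longrightarrow> u (t c) = t' c"
    using tableau_perm[OF tt] by blast
  have "s' x = (u \<circ> (s \<circ> inv u)) x" for x
  proof (cases "x < n")
    case True
    obtain r c where rc: "(r, c) \<in> cells lam" "t' (r, c) = x"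
      using tableau_cell[OF tt(2) True] by blast
    have rc': "(r, Suc c mod lam ! r) \<in> cells lam" using rc by (auto simp: cells_def)
    have "inv u x = t (r, c)" using u rc by (metis Sym_bij bij_cancel(6))
    then have "(u \<circ> (s \<circ> inv u)) x = u (t (r, Suc c mod lam ! r))"
      using t rc by (simp add: cyclic_tableau_def)
    also have "\<dots> = s' x" using t rc u(2)[OF rc'] by (auto simp: cyclic_tableau_def)
    finally show ?thesis by simp
  next
    case False
    then have out: "\<And>v. v \<in> Sym n \<Longrightarrow> v x = x" by (auto simp: Sym_def permutes_not_in)
    show ?thesis using out[OF s(1)] out[OF s(2)] out[OF u(1)] out[OF Sym_inv[OF u(1)]] by simp
  qed
  then show ?thesis using u(1) by blast
qed

text \<open>Induction on the invariant set \<open>A\<close>: split off the orbit of one point.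
  Non-empty lists are demanded because they become parts of a partition.\<close>

lemma cycle_lists_exist:
  assumes s: "permutation s" and "finite A" "\<And>x. x \<in> A \<Longrightarrow> s x \<in> A"
  shows "\<exists>cs. distinct (concat cs) \<and> set (concat cs) = A \<and> [] \<notin> set cs \<and>
    (\<forall>xs\<in>set cs. \<forall>i<length xs. s (xs ! i) = xs ! (Suc i mod length xs))"
  using assms(2,3)
proof (induction A rule: finite_psubset_induct)
  case (psubset A)
  show ?case
  proof (cases "A = {}")
    case True then show ?thesis by (intro exI[of _ "[]"]) auto
  next
    case False
    then obtain x where x: "x \<in> A" by blast
    define m where "m = least_power s x"
    have m: "(s ^^ m) x = x" "m > 0" using least_power_of_permutation[OF s] by (auto simp: m_def)
    define xs where "xs = support s x"
    have nth: "xs ! i = (s ^^ i) x" if "i < m" for i using that by (simp add: xs_def m_def)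
    have len: "length xs = m" by (simp add: xs_def m_def)
    have set: "set xs = (\<lambda>i. (s ^^ i) x) ` {0..<m}" by (simp add: xs_def m_def)
    have inA: "(s ^^ i) x \<in> A" for i using psubset.prems x by (induction i) auto
    have sub: "set xs \<subseteq> A" using inA by (auto simp: set)
    have "x \<in> set xs" using m by (auto simp: set intro!: image_eqI[of _ _ 0])
    then have "A - set xs \<subset> A" using x by auto
    moreover have "s y \<in> A - set xs" if "y \<in> A - set xs" for y
    proof -
      have inj: "inj s" using s by (auto simp: permutation bij_def)
      have "y \<in> set xs" if sy: "s y \<in> set xs"
      proof -
        obtain i where i: "i < m" "s y = (s ^^ i) x" using sy by (auto simp: set)
        \<comment> \<open>The index preceding \<open>i\<close> on the cycle; for
          \<open>i = 0\<close> it wraps round to \<open>m - 1\<close>, since the m-th iterate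
          returns to \<open>x\<close>. So anything mapped into the orbit was already in it.\<close>
        obtain k where k: "k < m" "s y = (s ^^ Suc k) x"
        proof (cases i)
          case 0
          then show ?thesis using i m by (intro that[of "m - 1"]) auto
        next
          case (Suc j)
          then show ?thesis using i by (intro that[of j]) auto
        qed
        then have "y = (s ^^ k) x" using inj by (simp add: inj_eq)
        then show ?thesis using k by (auto simp: set)
      qed
      then show ?thesis using \<open>y \<in> A - set xs\<close> psubset.prems by auto
    qed
    ultimately obtain cs where cs: "distinct (concat cs)" "set (concat cs) = A - set xs" "[] \<notin> set cs"
      "\<forall>xs\<in>set cs. \<forall>i<length xs. s (xs ! i) = xs ! (Suc i mod length xs)"
      using psubset.IH[of "A - set xs"] by blast
    have "s (xs ! i) = xs ! (Suc i mod length xs)" if "i < length xs" for i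
    proof (cases "Suc i = m")
      case True
      then show ?thesis using that m nth[of i] nth[of 0] by (auto simp: len)
    next
      case False
      then show ?thesis using that nth[of i] nth[of "Suc i"] by (simp add: len)
    qed
    moreover have "distinct xs" unfolding xs_def by (rule cycle_of_permutation[OF s])
    moreover have "xs \<noteq> []" using len m by auto
    ultimately show ?thesis
      using cs sub by (intro exI[of _ "xs # cs"]) auto
  qed
qed

lemma cyclic_tableau_exists:
  assumes s: "s \<in> Sym n"
  shows "\<exists>lam t. is_partition n lam \<and> cyclic_tableau n lam t s"
proof -
  obtain cs0 where cs0: "distinct (concat cs0)" "set (concat cs0) = {0..<n}" "[] \<notin> set cs0"
    "\<forall>xs\<in>set cs0. \<forall>i<length xs. s (xs ! i) = xs ! (Suc i mod length xs)"
    using cycle_lists_exist[OF Sym_permutation[OF s], of "{0..<n}"] Sym_less[OF s] by auto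
  \<comment> \<open>Cycles in order of decreasing length, as \<open>is_partition\<close>
    requires.\<close>
  define cs where "cs = rev (sort_key length cs0)"
  have set: "set cs = set cs0" by (simp add: cs_def)
  have "distinct cs0" using cs0(1,3) by (simp add: distinct_concat_iff)
  then have d: "distinct cs" by (simp add: cs_def)
  have dc: "distinct (concat cs)" using cs0(1,3) d by (simp add: distinct_concat_iff set)
  have sc: "set (concat cs) = {0..<n}" using cs0(2) set by simp
  define lam where "lam = map length cs"
  define t where "t = (\<lambda>(r, c). cs ! r ! c)"
  have cells: "(r, c) \<in> cells lam \<longleftrightarrow> r < length cs \<and> c < length (cs ! r)" for r c
    by (auto simp: cells_def lam_def)
  have "length (concat cs) = n" using distinct_card[OF dc] sc by simp
  then have "is_partition n lam"
    using cs0(3) by (auto simp: is_partition_def lam_def length_concat set)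
      (simp add: cs_def rev_map)
  moreover have "is_tableau n lam t"
    unfolding is_tableau_def
  proof (rule bij_betw_imageI)
    show "inj_on t (cells lam)"
    proof (rule inj_onI)
      fix a b assume ab: "a \<in> cells lam" "b \<in> cells lam" "t a = t b"
      obtain r c r' c' where [simp]: "a = (r, c)" "b = (r', c')" by fastforce
      have rc: "r < length cs" "c < length (cs ! r)" "r' < length cs" "c' < length (cs ! r')"
        using ab by (auto simp: cells)
      have eq: "cs ! r ! c = cs ! r' ! c'" using ab by (simp add: t_def)
      have "set (cs ! r) \<inter> set (cs ! r') \<noteq> {}"
        using rc eq by (metis disjoint_iff nth_mem)
      then have "cs ! r = cs ! r'" using dc rc unfolding distinct_concat_iff by (metis nth_mem)
      then have "r = r'" using d rc by (simp add: nth_eq_iff_index_eq)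
      moreover have "distinct (cs ! r)" using dc rc by (auto simp: distinct_concat_iff)
      ultimately show "a = b" using eq rc by (simp add: nth_eq_iff_index_eq)
    qed
    show "t ` cells lam = {0..<n}"
    proof -
      have "t ` cells lam = set (concat cs)"
      proof (intro equalityI subsetI)
        fix x assume "x \<in> t ` cells lam"
        then obtain r c where "r < length cs" "c < length (cs ! r)" "x = cs ! r ! c"
          by (auto simp: cells t_def)
        then show "x \<in> set (concat cs)" using nth_mem by fastforce
      next
        fix x assume "x \<in> set (concat cs)"
        then obtain r c where "r < length cs" "c < length (cs ! r)" "x = cs ! r ! c"
          by (auto simp: in_set_conv_nth)
        then show "x \<in> t ` cells lam"
          by (intro image_eqI[of _ _ "(r, c)"]) (auto simp: cells t_def)
      qed
      then show ?thesis using sc by simp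
    qed
  qed
  moreover have "s (t (r, c)) = t (r, Suc c mod lam ! r)" if "(r, c) \<in> cells lam" for r c
  proof -
    have rc: "r < length cs" "c < length (cs ! r)" using that by (simp_all add: cells)
    then have "cs ! r \<in> set cs0" using set nth_mem by blast
    then show ?thesis using cs0(4) rc by (simp add: t_def lam_def)
  qed
  ultimately show ?thesis unfolding cyclic_tableau_def by blast
qed

definition partitions :: "nat \<Rightarrow> nat list set" where
  "partitions n = {lam. is_partition n lam}"

lemma finite_partitions [simp]: "finite (partitions n)"
proof (rule finite_subset)
  show "partitions n \<subseteq> {xs. set xs \<subseteq> {..n} \<and> length xs \<le> n}"
  proof
    fix lam assume "lam \<in> partitions n"
    then have l: "\<forall>x\<in>set lam. 0 < x" "sum_list lam = n" by (auto simp: partitions_def is_partition_def)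
    have "length lam \<le> sum_list lam" using l(1) by (induction lam) auto
    moreover have "x \<le> n" if "x \<in> set lam" for x using member_le_sum_list[OF that] l(2) by simp
    ultimately show "lam \<in> {xs. set xs \<subseteq> {..n} \<and> length xs \<le> n}" using l(2) by auto
  qed
qed (rule finite_lists_length_le, simp)

subsection \<open>The central Young elements span the class functions\<close>

lemma sum_fun_apply: "(\<Sum>i\<in>I. f i) x = (\<Sum>i\<in>I. f i x)" for f :: "'i \<Rightarrow> 'a \<Rightarrow> real"
  by (induction I rule: infinite_finite_induct) auto

interpretation fun_vs: vector_space "\<lambda>(c::real) (f :: 'a \<Rightarrow> real). (\<lambda>x. c * f x)"
  by standard (auto simp: fun_eq_iff algebra_simps)

text \<open>Orthogonal functions of nonzero norm are independent. As many of them as there are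
  spanning functions \<open>T\<close> must span the same space: otherwise adjoining \<open>f\<close>
  would give too many independent vectors in the span of \<open>T\<close>.\<close>

lemma orthogonal_expansion:
  fixes B T :: "'i \<Rightarrow> 'a \<Rightarrow> real"
  assumes "finite I" "finite X"
    and nz: "\<And>i. i \<in> I \<Longrightarrow> (\<Sum>x\<in>X. B i x * B i x) \<noteq> 0"
    and orth: "\<And>i j. i \<in> I \<Longrightarrow> j \<in> I \<Longrightarrow> i \<noteq> j \<Longrightarrow> (\<Sum>x\<in>X. B i x * B j x) = 0"
    and B: "\<And>i. i \<in> I \<Longrightarrow> \<exists>c. \<forall>x\<in>X. B i x = (\<Sum>j\<in>I. c j * T j x)"
    and f: "\<exists>c. \<forall>x\<in>X. f x = (\<Sum>j\<in>I. c j * T j x)"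
  shows "\<exists>c. \<forall>x\<in>X. f x = (\<Sum>i\<in>I. c i * B i x)"
proof -
  \<comment> \<open>Cutting off outside \<open>X\<close> turns equality on \<open>X\<close> into
    equality of functions, so that the linear algebra of the full function space applies.\<close>
  define rs where "rs g x = (if x \<in> X then g x else 0)" for g :: "'a \<Rightarrow> real" and x
  let ?S = "(\<lambda>i. rs (B i)) ` I" and ?T = "(\<lambda>i. rs (T i)) ` I"
  have in_span: "rs g \<in> fun_vs.span ?T" if g: "\<exists>c. \<forall>x\<in>X. g x = (\<Sum>j\<in>I. c j * T j x)" for g
  proof -
    obtain c where c: "\<forall>x\<in>X. g x = (\<Sum>j\<in>I. c j * T j x)" using g by blast
    have "rs g = (\<Sum>j\<in>I. (\<lambda>x. c j * rs (T j) x))"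
      by (rule ext) (auto simp: sum_fun_apply rs_def c)
    also have "\<dots> \<in> fun_vs.span ?T"
      by (intro fun_vs.span_sum fun_vs.span_scale fun_vs.span_base) auto
    finally show ?thesis .
  qed
  have ip: "(\<Sum>x\<in>X. rs g x * rs h x) = (\<Sum>x\<in>X. g x * h x)" for g h
    by (rule sum.cong) (auto simp: rs_def)
  have inj: "inj_on (\<lambda>i. rs (B i)) I"
  proof (rule inj_onI, rule ccontr)
    fix i j assume ij: "i \<in> I" "j \<in> I" "rs (B i) = rs (B j)" "i \<noteq> j"
    then have "(\<Sum>x\<in>X. B i x * B i x) = (\<Sum>x\<in>X. B i x * B j x)" by (metis ip)
    then show False using nz[OF ij(1)] orth[OF ij(1,2,4)] by simp
  qed
  have indep: "fun_vs.independent ?S"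
  proof
    assume "fun_vs.dependent ?S"
    then obtain u where u: "\<exists>v\<in>?S. u v \<noteq> 0" "(\<Sum>v\<in>?S. (\<lambda>x. u v * v x)) = 0"
      using assms(1) by (subst (asm) fun_vs.dependent_finite) auto
    from u(1) obtain i where i: "i \<in> I" "u (rs (B i)) \<noteq> 0" by auto
    have eq: "(\<Sum>j\<in>I. (\<lambda>x. u (rs (B j)) * rs (B j) x)) = 0"
      using u(2) by (simp add: sum.reindex[OF inj])
    have "(\<Sum>j\<in>I. u (rs (B j)) * rs (B j) x) = 0" for x
      using fun_cong[OF eq, of x] by (simp only: sum_fun_apply zero_fun_apply)
    then have "0 = (\<Sum>x\<in>X. (\<Sum>j\<in>I. u (rs (B j)) * rs (B j) x) * rs (B i) x)" by simp
    also have "\<dots> = (\<Sum>j\<in>I. u (rs (B j)) * (\<Sum>x\<in>X. rs (B j) x * rs (B i) x))"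
      unfolding sum_distrib_right sum_distrib_left by (subst sum.swap) (simp add: mult.assoc)
    also have "\<dots> = (\<Sum>j\<in>I. if j = i then u (rs (B i)) * (\<Sum>x\<in>X. B i x * B i x) else 0)"
      by (rule sum.cong) (auto simp: ip orth i)
    also have "\<dots> = u (rs (B i)) * (\<Sum>x\<in>X. B i x * B i x)" using i assms(1) by simp
    finally show False using nz[OF i(1)] i(2) by simp
  qed
  have "rs f \<in> fun_vs.span ?S"
  proof (rule ccontr)
    assume nin: "rs f \<notin> fun_vs.span ?S"
    then have "fun_vs.independent (insert (rs f) ?S)"
      using indep by (simp add: fun_vs.independent_insert)
    moreover have "insert (rs f) ?S \<subseteq> fun_vs.span ?T" using in_span B f by auto
    ultimately have "card (insert (rs f) ?S) \<le> card ?T"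
      using fun_vs.independent_span_bound[of ?T "insert (rs f) ?S"] assms(1) by blast
    also have "\<dots> \<le> card I" by (rule card_image_le[OF assms(1)])
    also have "\<dots> = card ?S" by (simp add: card_image[OF inj])
    also have "\<dots> < card (insert (rs f) ?S)"
      using nin fun_vs.span_base[of "rs f" ?S] assms(1) by (subst card_insert_disjoint) auto
    finally show False by simp
  qed
  then obtain u where "rs f = (\<Sum>v\<in>?S. (\<lambda>x. u v * v x))"
    using assms(1) by (subst (asm) fun_vs.span_finite) auto
  then have "rs f = (\<Sum>i\<in>I. (\<lambda>x. u (rs (B i)) * rs (B i) x))"
    by (simp add: sum.reindex[OF inj])
  then have exp: "rs f x = (\<Sum>i\<in>I. u (rs (B i)) * rs (B i) x)" for x
    by (simp add: sum_fun_apply)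
  define c where "c i = u (rs (B i))" for i
  have "f x = (\<Sum>i\<in>I. c i * B i x)" if "x \<in> X" for x
    using exp[of x, folded c_def] that by (simp add: rs_def)
  then show ?thesis by blast
qed

text \<open>Permutations with the same chosen cycle shape are conjugate, so the indicators of the
  shapes span the class functions. This bounds their dimension by the number of partitions, matching
  the size of the orthogonal family \<open>cyoung\<close>.\<close>

lemma class_function_expansion:
  "\<exists>T :: nat list \<Rightarrow> (nat \<Rightarrow> nat) \<Rightarrow> real. \<forall>f.
     (\<forall>u\<in>Sym n. \<forall>x\<in>Sym n. f (u \<circ> (x \<circ> inv u)) = f x) \<longrightarrow>
     (\<exists>c. \<forall>x\<in>Sym n. f x = (\<Sum>lam\<in>partitions n. c lam * T lam x))"
proof -
  define ct where "ct x = (SOME lam. is_partition n lam \<and> (\<exists>t. cyclic_tableau n lam t x))" for x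
  have ct: "is_partition n (ct x) \<and> (\<exists>t. cyclic_tableau n (ct x) t x)" if "x \<in> Sym n" for x
    unfolding ct_def by (rule someI_ex) (use cyclic_tableau_exists[OF that] in blast)
  \<comment> \<open>For a shape that \<open>ct\<close> does not take, \<open>rep\<close> is
    arbitrary; the corresponding indicator vanishes on \<open>Sym n\<close>.\<close>
  define rep where "rep lam = (SOME x. x \<in> Sym n \<and> ct x = lam)" for lam
  have "\<exists>c. \<forall>x\<in>Sym n. f x = (\<Sum>lam\<in>partitions n. c lam * (if ct x = lam then 1 else 0))"
    if f: "\<forall>u\<in>Sym n. \<forall>x\<in>Sym n. f (u \<circ> (x \<circ> inv u)) = f x" for f :: "(nat \<Rightarrow> nat) \<Rightarrow> real"
  proof (intro exI ballI)
    fix x assume x: "x \<in> Sym n"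
    have r: "rep (ct x) \<in> Sym n \<and> ct (rep (ct x)) = ct x"
      unfolding rep_def by (rule someI[of _ x]) (use x in simp)
    obtain t t' where "cyclic_tableau n (ct x) t x" "cyclic_tableau n (ct x) t' (rep (ct x))"
      using ct[OF x] ct[of "rep (ct x)"] r by metis
    then obtain u where "u \<in> Sym n" "rep (ct x) = u \<circ> (x \<circ> inv u)"
      using cyclic_tableau_conj[OF x] r by metis
    then have "f x = f (rep (ct x))" using f x by simp
    then show "f x = (\<Sum>lam\<in>partitions n. f (rep lam) * (if ct x = lam then 1 else 0))"
      using ct[OF x] sum.delta'[OF finite_partitions, where a = "ct x" and b = "\<lambda>lam. f (rep lam)"]
      by (simp add: partitions_def if_distrib[of "\<lambda>z. _ * z"] cong: if_cong)
  qed
  then show ?thesis by (intro exI[of _ "\<lambda>lam x. if ct x = lam then 1 else 0"]) blast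
qed

theorem delta_id_expansion:
  assumes tab: "\<And>lam. is_partition n lam \<Longrightarrow> is_tableau n lam (tab lam)"
  shows "\<exists>c. (\<forall>lam\<in>partitions n. c lam > 0) \<and>
    (\<forall>x\<in>Sym n. delta id x = (\<Sum>lam\<in>partitions n. c lam * cyoung n lam (tab lam) x))"
proof -
  let ?B = "\<lambda>lam. cyoung n lam (tab lam)"
  have t: "is_tableau n lam (tab lam)" if "lam \<in> partitions n" for lam
    using that tab by (simp add: partitions_def)
  have pos: "(\<Sum>x\<in>Sym n. ?B lam x * ?B lam x) > 0" if "lam \<in> partitions n" for lam
  proof (rule sum_pos2[of _ id])
    show "0 < ?B lam id * ?B lam id" by (simp add: cyoung_id[OF t[OF that]])
  qed auto
  have orth: "(\<Sum>x\<in>Sym n. ?B lam x * ?B mu x) = 0"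
    if "lam \<in> partitions n" "mu \<in> partitions n" "lam \<noteq> mu" for lam mu
    using that by (intro cyoung_orthogonal t) (auto simp: partitions_def)
  obtain T :: "nat list \<Rightarrow> (nat \<Rightarrow> nat) \<Rightarrow> real" where T: "\<forall>f. (\<forall>u\<in>Sym n. \<forall>x\<in>Sym n. f (u \<circ> (x \<circ> inv u)) = f x) \<longrightarrow>
     (\<exists>c. \<forall>x\<in>Sym n. f x = (\<Sum>lam\<in>partitions n. c lam * T lam x))"
    using class_function_expansion[of n] by blast
  have "u \<circ> (x \<circ> inv u) = id \<longleftrightarrow> x = id" if "u \<in> Sym n" for u x :: "nat \<Rightarrow> nat"
  proof
    assume e: "u \<circ> (x \<circ> inv u) = id"
    have "x = inv u \<circ> ((u \<circ> (x \<circ> inv u)) \<circ> u)" using that by (simp add: comp_assoc)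
    then show "x = id" unfolding e using that by simp
  qed (use that in simp)
  then have "\<exists>c. \<forall>x\<in>Sym n. delta id x = (\<Sum>lam\<in>partitions n. c lam * T lam x)"
    by (intro T[THEN spec, THEN mp]) (simp add: delta_def)
  moreover have "\<exists>c. \<forall>x\<in>Sym n. ?B lam x = (\<Sum>lam\<in>partitions n. c lam * T lam x)" for lam
    by (intro T[THEN spec, THEN mp]) (simp add: cyoung_def cavg_conj)
  ultimately obtain c where c: "\<forall>x\<in>Sym n. delta id x = (\<Sum>lam\<in>partitions n. c lam * ?B lam x)"
    using orthogonal_expansion[of "partitions n" "Sym n" ?B T "delta id", OF finite_partitions finite_Sym
        less_imp_neq[OF pos, symmetric] orth] by blast
  have "c mu > 0" if mu: "mu \<in> partitions n" for mu
  proof -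
    \<comment> \<open>Pairing the expansion with \<open>?B mu\<close>: the left side is the
      coefficient n! at the identity, and orthogonality leaves one term on the right.\<close>
    have "fact n = (\<Sum>x\<in>Sym n. delta id x * ?B mu x)"
      by (simp add: delta_def if_distrib[of "\<lambda>z. z * _"] sum.delta cyoung_id[OF t[OF mu]] cong: if_cong)
    also have "\<dots> = (\<Sum>x\<in>Sym n. \<Sum>lam\<in>partitions n. c lam * (?B lam x * ?B mu x))"
      by (rule sum.cong) (simp_all add: c sum_distrib_right mult.assoc)
    also have "\<dots> = (\<Sum>lam\<in>partitions n. c lam * (\<Sum>x\<in>Sym n. ?B lam x * ?B mu x))"
      by (subst sum.swap) (simp add: sum_distrib_left)
    also have "\<dots> = (\<Sum>lam\<in>partitions n. if lam = mu then c mu * (\<Sum>x\<in>Sym n. ?B mu x * ?B mu x) else 0)"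
      by (rule sum.cong) (auto simp: orth mu)
    also have "\<dots> = c mu * (\<Sum>x\<in>Sym n. ?B mu x * ?B mu x)" using mu by simp
    finally have "c mu * (\<Sum>x\<in>Sym n. ?B mu x * ?B mu x) > 0"
      by (metis fact_gt_zero)
    then show ?thesis using pos[OF mu] by (simp add: zero_less_mult_iff)
  qed
  then show ?thesis using c by blast
qed

subsection \<open>Specht modules inside the polynomial representation\<close>

lemma fspan_eq: "fspan A = fun_vs.span A"
proof -
  have "(\<lambda>x. \<Sum>b\<in>B. c b * b x) = (\<Sum>b\<in>B. (\<lambda>x. c b * b x))" for B and c :: "('a \<Rightarrow> real) \<Rightarrow> real"
    by (rule ext) (simp add: sum_fun_apply)
  then show ?thesis unfolding fspan_def fun_vs.span_explicit by auto
qed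

lemma fsubspace_eq: "fsubspace U = fun_vs.subspace U"
  unfolding fsubspace_def fun_vs.subspace_def zero_fun_def plus_fun_def by blast

lemma fspan_induct [consumes 1, case_names zero scale_add]:
  assumes "f \<in> fspan A" "Q (\<lambda>x. 0)"
    "\<And>c g h. g \<in> A \<Longrightarrow> Q h \<Longrightarrow> Q (\<lambda>x. c * g x + h x)"
  shows "Q f"
  using assms(1) unfolding fspan_eq
proof (induction rule: fun_vs.span_induct_alt)
  case base then show ?case using assms(2) by (simp add: zero_fun_def)
next
  case (step c x y) then show ?case using assms(3)[of x y c] by (simp add: plus_fun_def)
qed

lemma fspan_sub: "A \<subseteq> fspan A"
  unfolding fspan_eq by (rule fun_vs.span_superset)

lemma fspan_base: "f \<in> A \<Longrightarrow> f \<in> fspan A"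
  using fspan_sub by (rule subsetD)

lemma fsubspace_fspan: "fsubspace (fspan A)"
  unfolding fspan_eq fsubspace_eq by simp

lemma fsubspace_zero: "fsubspace U \<Longrightarrow> (\<lambda>x. 0) \<in> U"
  and fsubspace_add: "fsubspace U \<Longrightarrow> f \<in> U \<Longrightarrow> g \<in> U \<Longrightarrow> (\<lambda>x. f x + g x) \<in> U"
  and fsubspace_scale: "fsubspace U \<Longrightarrow> f \<in> U \<Longrightarrow> (\<lambda>x. c * f x) \<in> U"
  by (auto simp: fsubspace_def)

lemma fsubspace_sum:
  assumes "fsubspace U" "\<And>i. i \<in> I \<Longrightarrow> f i \<in> U"
  shows "(\<lambda>x. \<Sum>i\<in>I. f i x) \<in> U"
  using assms(2)
  by (induction I rule: infinite_finite_induct) (auto intro: fsubspace_zero fsubspace_add assms(1))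

text \<open>By linearity the middle factor may be a single permutation \<open>s\<close>. Without a
  clash it factors as a column times a row permutation, both absorbed up to sign; with a clash the
  product vanishes.\<close>

lemma col_row_multiple:
  assumes lam: "is_partition n lam" and t: "is_tableau n lam t"
  shows "\<exists>k. conv n (colsym n lam t) (conv n z (rowsym n lam t)) = (\<lambda>x. k * young n lam t x)"
proof -
  let ?b = "colsym n lam t" and ?a = "rowsym n lam t"
  have "\<exists>k. conv n ?b (conv n (delta s) ?a) = (\<lambda>x. k * young n lam t x)" if s: "s \<in> Sym n" for s
  proof (cases "noclash n lam (s \<circ> t) lam t")
    case True
    obtain p q where "p \<in> col_group n lam t" "q \<in> row_group n lam t" "s = p \<circ> q"
      using noclash_factor[OF lam t s True] by blast
    then show ?thesis
      using tw_delta_tw[OF col_group_twisted[OF t] row_group_twisted[OF t], of p q]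
      unfolding young_def colsym_def rowsym_def by blast
  next
    case False
    then obtain i j where ij: "i < n" "j < n" "i \<noteq> j" "colof lam t i = colof lam t j"
      "rowof lam (s \<circ> t) i = rowof lam (s \<circ> t) j"
      by (auto simp: noclash_def)
    let ?q = "Transposition.transpose i j"
    have r: "inv s \<circ> (?q \<circ> s) \<in> row_group n lam t"
      using ij s by (simp add: conj_transpose transpose_row_group[OF t] Sym_less tableau_comp_pos[OF t])
    \<comment> \<open>The translate of the row symmetrizer by \<open>s\<close> absorbs
      \<open>?q\<close>, because the conjugate of \<open>?q\<close> by \<open>s\<close> is a row
      permutation, whereas \<open>?b\<close> changes sign under \<open>?q\<close>.\<close>
    have "conv n ?b (\<lambda>x. ?a (inv s \<circ> x)) = (\<lambda>_. 0)"
      unfolding colsym_def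
    proof (rule reg.gop_tw_zero[OF col_group_twisted[OF t]])
      show "?q \<in> col_group n lam t" using transpose_col_group[OF t] ij by simp
      show "real_of_int (sign ?q) = -1" using ij by (simp add: sign_swap_id)
      fix x :: "nat \<Rightarrow> nat"
      have q: "?q \<in> Sym n" using ij by (simp add: transpose_Sym)
      have "inv s \<circ> (inv ?q \<circ> x) = inv (inv s \<circ> (?q \<circ> s)) \<circ> (inv s \<circ> x)"
        using s q by (simp add: comp_assoc)
      then show "?a (inv s \<circ> (inv ?q \<circ> x)) = ?a (inv s \<circ> x)"
        unfolding rowsym_def using r
        by (simp only: twisted.tw_left[OF row_group_twisted[OF t] twisted.inv_mem[OF row_group_twisted[OF t] r]] mult_1)
    qed
    then have "conv n ?b (conv n (delta s) ?a) = (\<lambda>x. 0 * young n lam t x)"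
      using s by (simp add: gop_delta)
    then show ?thesis by blast
  qed
  then obtain k where k: "\<And>s. s \<in> Sym n \<Longrightarrow> conv n ?b (conv n (delta s) ?a) = (\<lambda>x. k s * young n lam t x)"
    by metis
  have "conv n z ?a = (\<lambda>x. \<Sum>s\<in>Sym n. z s * conv n (delta s) ?a x)"
    by (rule ext, unfold conv_apply[of n z], rule sum.cong) (auto simp: gop_delta)
  then have "conv n ?b (conv n z ?a) = (\<lambda>x. \<Sum>s\<in>Sym n. z s * conv n ?b (conv n (delta s) ?a) x)"
    by (simp only: gop_sum_right gop_scale_right)
  also have "\<dots> = (\<lambda>x. \<Sum>s\<in>Sym n. z s * (k s * young n lam t x))"
    by (rule ext, rule sum.cong) (simp_all add: k)
  also have "\<dots> = (\<lambda>x. (\<Sum>s\<in>Sym n. z s * k s) * young n lam t x)"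
    by (simp add: sum_distrib_right mult.assoc)
  finally show ?thesis by blast
qed

section \<open>Tabloid functions lifted to the group\<close>

lemma tabloid_comp: "tabloid lam (s \<circ> t) = tab_act s (tabloid lam t)"
  by (simp add: tabloid_def tab_act_def image_comp)

lemma tabloid_act_eq: "tabloid_act s F = (\<lambda>T. F (tab_act (inv s) T))"
  by (simp add: tabloid_act_def tab_act_def)

lemma act_eq: "act s f = (\<lambda>G. f (graph_act (inv s) G))"
  by (simp add: act_def)

lemma tabloid_eq_row_group:
  assumes t: "is_tableau n lam t" and s: "s \<in> Sym n" and p: "p \<in> Sym n"
  shows "tabloid lam (s \<circ> t) = tabloid lam (p \<circ> t) \<longleftrightarrow> inv p \<circ> s \<in> row_group n lam t"
proof -
  have "tabloid lam (s \<circ> t) = tabloid lam (p \<circ> t) \<longleftrightarrow> (\<forall>x<n. rowof lam t (inv s x) = rowof lam t (inv p x))"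
    using tabloid_eq_iff[OF tableau_comp[OF t s] tableau_comp[OF t p]] by (simp add: tableau_comp_pos[OF t] s p)
  also have "\<dots> \<longleftrightarrow> (\<forall>y<n. rowof lam t (inv p (s y)) = rowof lam t y)"
  proof (intro iffI allI impI)
    fix y assume *: "\<forall>x<n. rowof lam t (inv s x) = rowof lam t (inv p x)" and y: "y < n"
    show "rowof lam t (inv p (s y)) = rowof lam t y"
      using *[rule_format, of "s y"] y s by (simp add: Sym_less)
  next
    fix x assume *: "\<forall>y<n. rowof lam t (inv p (s y)) = rowof lam t y" and x: "x < n"
    show "rowof lam t (inv s x) = rowof lam t (inv p x)"
      using *[rule_format, of "inv s x"] x s Sym_less[OF Sym_inv[OF s]] by simp
  qed
  also have "\<dots> \<longleftrightarrow> inv p \<circ> s \<in> row_group n lam t"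
    using s p by (simp add: row_group_iff[OF t])
  finally show ?thesis .
qed

text \<open>Pullback along the orbit map of the tabloid of \<open>t\<close>: functions on tabloids
  become functions on the group that are constant on left cosets of the row group. Elements of a
  Specht module can then act as group algebra elements.\<close>

definition hat :: "nat list \<Rightarrow> (nat \<times> nat \<Rightarrow> nat) \<Rightarrow> (nat set list \<Rightarrow> real) \<Rightarrow> (nat \<Rightarrow> nat) \<Rightarrow> real" where
  "hat lam t F s = F (tabloid lam (s \<circ> t))"

text \<open>The term of \<open>p\<close> is nonzero at \<open>s\<close> exactly when
  \<open>inv p \<circ> s\<close> is a row permutation, which is the convolution of the column and
  row sums.\<close>

lemma hat_polytabloid:
  assumes t: "is_tableau n lam t" and s: "s \<in> Sym n"
  shows "hat lam t (polytabloid n lam t) s = young n lam t s"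
proof -
  have "young n lam t s = (\<Sum>p\<in>Sym n. if p \<in> col_group n lam t
      then of_int (sign p) * (if tabloid lam (s \<circ> t) = tabloid lam (p \<circ> t) then 1 else 0) else 0)"
    unfolding young_def conv_apply
    by (rule sum.cong) (auto simp: colsym_def rowsym_def twisted.tw_def[OF row_group_twisted[OF t]]
        twisted.tw_def[OF col_group_twisted[OF t]] tabloid_eq_row_group[OF t s])
  also have "\<dots> = (\<Sum>p\<in>Sym n \<inter> col_group n lam t.
      of_int (sign p) * (if tabloid lam (s \<circ> t) = tabloid lam (p \<circ> t) then 1 else 0))"
    by (simp add: sum.inter_restrict)
  also have "Sym n \<inter> col_group n lam t = col_group n lam t" by (auto simp: col_group_def)
  finally show ?thesis unfolding hat_def polytabloid_def by (rule sym)
qed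

lemma col_group_comp:
  assumes t: "is_tableau n lam t" and s: "s \<in> Sym n"
  shows "p \<in> col_group n lam (s \<circ> t) \<longleftrightarrow> inv s \<circ> (p \<circ> s) \<in> col_group n lam t"
proof (cases "p \<in> Sym n")
  case True
  have "p \<in> col_group n lam (s \<circ> t) \<longleftrightarrow> (\<forall>x<n. colof lam t (inv s (p x)) = colof lam t (inv s x))"
    using True by (simp add: col_group_iff[OF tableau_comp[OF t s]] tableau_comp_pos[OF t s] Sym_less)
  also have "\<dots> \<longleftrightarrow> (\<forall>y<n. colof lam t (inv s (p (s y))) = colof lam t y)"
  proof (intro iffI allI impI)
    fix y assume *: "\<forall>x<n. colof lam t (inv s (p x)) = colof lam t (inv s x)" and y: "y < n"
    show "colof lam t (inv s (p (s y))) = colof lam t y"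
      using *[rule_format, of "s y"] y s by (simp add: Sym_less)
  next
    fix x assume *: "\<forall>y<n. colof lam t (inv s (p (s y))) = colof lam t y" and x: "x < n"
    show "colof lam t (inv s (p x)) = colof lam t (inv s x)"
      using *[rule_format, of "inv s x"] x s Sym_less[OF Sym_inv[OF s]] by simp
  qed
  finally show ?thesis using True s by (simp add: col_group_iff[OF t])
next
  case False
  then show ?thesis using s by (auto simp: col_group_def)
qed

lemma polytabloid_comp:
  assumes t: "is_tableau n lam t" and s: "s \<in> Sym n"
  shows "polytabloid n lam (s \<circ> t) = tabloid_act s (polytabloid n lam t)"
proof
  fix T
  have "polytabloid n lam (s \<circ> t) T = (\<Sum>q\<in>col_group n lam t.
      of_int (sign (s \<circ> (q \<circ> inv s))) * (if T = tabloid lam (s \<circ> (q \<circ> inv s) \<circ> (s \<circ> t)) then 1 else 0))"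
    unfolding polytabloid_def
    by (rule sum.reindex_bij_witness[of _ "\<lambda>q. s \<circ> (q \<circ> inv s)" "\<lambda>p. inv s \<circ> (p \<circ> s)"])
      (use s in \<open>auto simp: col_group_comp[OF t s] comp_assoc\<close>)
  also have "\<dots> = (\<Sum>q\<in>col_group n lam t. of_int (sign q) * (if tab_act (inv s) T = tabloid lam (q \<circ> t) then 1 else 0))"
  proof (rule sum.cong[OF refl])
    fix q assume "q \<in> col_group n lam t"
    then have q: "q \<in> Sym n" by (simp add: col_group_def)
    have sg: "sign (s \<circ> (q \<circ> inv s)) = sign q"
      using Sym_permutation[OF s] Sym_permutation[OF q] Sym_permutation[OF Sym_inv[OF s]]
      by (simp add: sign_compose permutation_compose sign_inverse mult.left_commute)
    have "s \<circ> (q \<circ> inv s) \<circ> (s \<circ> t) = s \<circ> (q \<circ> t)" using s by (simp add: comp_assoc)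
    moreover have "T = tab_act s T' \<longleftrightarrow> tab_act (inv s) T = T'" for T'
      using s tabl.comp[of "inv s" s T'] tabl.comp[of s "inv s" T] by (auto simp: tabl.id)
    ultimately show "of_int (sign (s \<circ> (q \<circ> inv s))) * (if T = tabloid lam (s \<circ> (q \<circ> inv s) \<circ> (s \<circ> t)) then 1 else 0)
       = of_int (sign q) * (if tab_act (inv s) T = tabloid lam (q \<circ> t) then 1 else (0::real))"
      using sg by (simp add: tabloid_comp[of lam s])
  qed
  finally show "polytabloid n lam (s \<circ> t) T = tabloid_act s (polytabloid n lam t) T"
    by (simp add: tabloid_act_eq polytabloid_def)
qed

text \<open>Any other tableau of the shape is a relabelling of \<open>t\<close>, so the Specht
  module is cyclic, generated by one polytabloid.\<close>

lemma Specht_eq: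
  assumes t: "is_tableau n lam t"
  shows "Specht n lam = fspan ((\<lambda>s. tabloid_act s (polytabloid n lam t)) ` Sym n)"
proof -
  have "{polytabloid n lam t | t. is_tableau n lam t} = (\<lambda>s. tabloid_act s (polytabloid n lam t)) ` Sym n"
  proof (intro equalityI subsetI)
    fix e assume "e \<in> {polytabloid n lam t | t. is_tableau n lam t}"
    then obtain u where u: "is_tableau n lam u" "e = polytabloid n lam u" by blast
    obtain s where s: "s \<in> Sym n" "\<And>c. c \<in> cells lam \<Longrightarrow> s (t c) = u c"
      using tableau_perm[OF t u(1)] by blast
    have "polytabloid n lam u = polytabloid n lam (s \<circ> t)"
    proof -
      have "tabloid lam (p \<circ> u) = tabloid lam (p \<circ> (s \<circ> t))" for p
        by (rule tableau_cong(2)) (simp add: s(2))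
      moreover have "col_group n lam u = col_group n lam (s \<circ> t)"
        by (rule tableau_cong(3)) (simp add: s(2))
      ultimately show ?thesis by (simp add: polytabloid_def)
    qed
    then show "e \<in> (\<lambda>s. tabloid_act s (polytabloid n lam t)) ` Sym n"
      using u s by (simp add: polytabloid_comp[OF t])
  next
    fix e assume "e \<in> (\<lambda>s. tabloid_act s (polytabloid n lam t)) ` Sym n"
    then obtain s where s: "s \<in> Sym n" "e = polytabloid n lam (s \<circ> t)"
      by (auto simp: polytabloid_comp[OF t])
    then show "e \<in> {polytabloid n lam t | t. is_tableau n lam t}"
      using tableau_comp[OF t s(1)] by blast
  qed
  then show ?thesis by (simp add: Specht_def)
qed

lemma hat_act:
  assumes "s \<in> Sym n"
  shows "hat lam t (tabloid_act s F) = conv n (delta s) (hat lam t F)"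
  using assms by (simp add: gop_delta hat_def tabloid_act_eq tabloid_comp[symmetric] comp_assoc fun_eq_iff)

text \<open>Since the module is generated by one polytabloid, its lift lies in the left ideal
  generated by the Young symmetrizer.\<close>

lemma hat_Specht:
  assumes t: "is_tableau n lam t" and F: "F \<in> Specht n lam"
  shows "\<exists>y. \<forall>s\<in>Sym n. hat lam t F s = conv n y (young n lam t) s"
  using F unfolding Specht_eq[OF t]
proof (induction rule: fspan_induct)
  case zero
  show ?case by (intro exI[of _ "\<lambda>_. 0"]) (simp add: hat_def)
next
  case (scale_add c g h)
  then obtain s y where s: "s \<in> Sym n" "g = tabloid_act s (polytabloid n lam t)"
    and y: "\<forall>s\<in>Sym n. hat lam t h s = conv n y (young n lam t) s" by blast
  have "hat lam t (\<lambda>x. c * g x + h x) u = conv n (\<lambda>x. c * delta s x + y x) (young n lam t) u"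
    if u: "u \<in> Sym n" for u
  proof -
    have "hat lam t g u = hat lam t (polytabloid n lam t) (inv s \<circ> u)"
      using s by (simp add: hat_act[OF s(1)] gop_delta)
    also have "\<dots> = conv n (delta s) (young n lam t) u"
      using s u by (simp add: hat_polytabloid[OF t] gop_delta)
    finally show ?thesis
      using y u by (simp add: hat_def gop_add_left gop_scale_left)
  qed
  then show ?case by blast
qed

text \<open>The type \<open>nat set list\<close> contains lists that are not tabloids. Elements of
  the Specht module are supported on the orbit of the tabloid of \<open>t\<close>, where the lift
  records every value.\<close>

lemma hat_inj:
  assumes t: "is_tableau n lam t" and F: "F \<in> Specht n lam" and z: "\<And>s. s \<in> Sym n \<Longrightarrow> hat lam t F s = 0"
  shows "F = (\<lambda>_. 0)"
proof -
  have "\<forall>T. F T \<noteq> 0 \<longrightarrow> (\<exists>s\<in>Sym n. T = tabloid lam (s \<circ> t))"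
    using F unfolding Specht_eq[OF t]
  proof (induction rule: fspan_induct)
    case (scale_add c g h)
    then obtain s where s: "s \<in> Sym n" "g = polytabloid n lam (s \<circ> t)"
      using polytabloid_comp[OF t] by auto
    have "\<exists>u\<in>Sym n. T = tabloid lam (u \<circ> t)" if gT: "g T \<noteq> 0" for T
    proof -
      obtain p where "p \<in> col_group n lam (s \<circ> t)"
        and ne: "of_int (sign p) * (if T = tabloid lam (p \<circ> (s \<circ> t)) then 1 else 0) \<noteq> (0::real)"
        using gT unfolding s(2) polytabloid_def by (rule sum.not_neutral_contains_not_neutral)
      moreover from ne have "T = tabloid lam (p \<circ> (s \<circ> t))" by (metis mult_zero_right)
      ultimately have "p \<in> col_group n lam (s \<circ> t)" "T = tabloid lam (p \<circ> (s \<circ> t))" by blast+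
      then show ?thesis using s(1) by (intro bexI[of _ "p \<circ> s"]) (auto simp: comp_assoc col_group_def)
    qed
    then show ?case using scale_add.IH by (metis add.right_neutral mult_zero_right)
  qed simp
  then show ?thesis using z unfolding hat_def by blast
qed

text \<open>The submodule theorem in the group algebra: a left ideal inside the one generated by a Young
  symmetrizer that does not contain the symmetrizer is orthogonal to itself.\<close>

lemma (in set_action) hat_gop_inj:
  assumes lam: "is_partition n lam" and t: "is_tableau n lam t" and F: "F \<in> Specht n lam"
    and zero: "gop n \<rho> (hat lam t F) m = (\<lambda>_. 0)" and nz: "gop n \<rho> (young n lam t) m \<noteq> (\<lambda>_. 0)"
  shows "F = (\<lambda>_. 0)"
proof -
  let ?a = "rowsym n lam t" and ?b = "colsym n lam t"
  obtain y where y: "\<forall>s\<in>Sym n. hat lam t F s = conv n y (young n lam t) s"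
    using hat_Specht[OF t F] by blast
  define \<phi> where "\<phi> = conv n y (young n lam t)"
  have z: "gop n \<rho> \<phi> m = (\<lambda>_. 0)"
    using zero gop_cong[of n "hat lam t F" \<phi> \<rho> m] y by (simp add: \<phi>_def)
  \<comment> \<open>Through \<open>y\<close> the product rearranges to b z a, a multiple
    \<open>k\<close> of the Young symmetrizer. Applied to \<open>m\<close> it gives zero because
    \<open>\<phi>\<close> does, while the symmetrizer itself does not, so
    \<open>k = 0\<close>.\<close>
  have bz: "conv n ?b (conv n w \<phi>) = (\<lambda>_. 0)" for w
  proof -
    have eq: "conv n ?b (conv n w \<phi>) = conv n ?b (conv n (conv n (conv n w y) ?b) ?a)"
      unfolding \<phi>_def young_def by (simp only: reg.gop_gop)
    obtain k where k: "conv n ?b (conv n w \<phi>) = (\<lambda>x. k * young n lam t x)"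
      unfolding eq using col_row_multiple[OF lam t] by blast
    have "(\<lambda>_. 0) = gop n \<rho> ?b (gop n \<rho> w (gop n \<rho> \<phi> m))" by (simp add: z)
    also have "\<dots> = gop n \<rho> (conv n ?b (conv n w \<phi>)) m" by (simp only: gop_gop)
    also have "\<dots> = (\<lambda>x. k * gop n \<rho> (young n lam t) m x)" by (simp only: k gop_scale_left)
    finally have "k = 0" using nz by (auto simp: fun_eq_iff)
    then show ?thesis using k by simp
  qed
  define y' where "y' t = y (inv t)" for t
  have star: "\<phi> (inv s) = conv n ?a (conv n ?b y') s" if s: "s \<in> Sym n" for s
  proof -
    have "\<phi> (inv s) = conv n (\<lambda>u. young n lam t (inv u)) y' s"
      unfolding \<phi>_def y'_def by (rule conv_star[OF s])
    also have "\<dots> = conv n (conv n ?a ?b) y' s"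
    proof (rule fun_cong[OF gop_cong])
      fix u assume u: "u \<in> Sym n"
      show "young n lam t (inv u) = conv n ?a ?b u"
        unfolding young_def by (rule conv_inv[OF u]) (simp_all add: rowsym_inv[OF t] colsym_inv[OF t])
    qed
    finally show ?thesis by (simp only: reg.gop_gop)
  qed
  \<comment> \<open>The squared norm of \<open>\<phi>\<close> is the identity coefficient of its
    star times itself. That product begins with a b and ends with \<open>\<phi>\<close>, so
    \<open>bz\<close> kills it; over the reals all coefficients vanish.\<close>
  have "(\<Sum>s\<in>Sym n. \<phi> s * \<phi> s) = (\<Sum>s\<in>Sym n. \<phi> (inv s) * \<phi> (inv s \<circ> id))"
    using sum_Sym_inv[of "\<lambda>s. \<phi> s * \<phi> s" n] by simp
  also have "\<dots> = conv n (conv n ?a (conv n ?b y')) \<phi> id"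
    unfolding conv_apply[of n "conv n ?a (conv n ?b y')"] by (rule sum.cong) (simp_all add: star)
  also have "conv n (conv n ?a (conv n ?b y')) \<phi> = conv n ?a (conv n ?b (conv n y' \<phi>))"
    by (simp only: reg.gop_gop)
  also have "\<dots> = (\<lambda>_. 0)" by (simp add: bz)
  finally have "\<forall>s\<in>Sym n. \<phi> s * \<phi> s = 0"
    by (subst (asm) sum_nonneg_eq_0_iff) auto
  then show ?thesis using hat_inj[OF t F] y by (simp add: \<phi>_def)
qed

section \<open>The action on polynomials of bounded degree\<close>

lemma finite_Edges: "finite (Edges n)"
  by (rule finite_subset[of _ "Pow {..<n}"]) (auto simp: Edges_def)

lemma graph_act_Edges: "s \<in> Sym n \<Longrightarrow> G \<subseteq> Edges n \<Longrightarrow> graph_act s G \<subseteq> Edges n"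
proof
  fix e assume s: "s \<in> Sym n" "G \<subseteq> Edges n" and "e \<in> graph_act s G"
  then obtain i j where ij: "e = {s i, s j}" "i < j" "j < n"
    by (auto simp: graph_act_def Edges_def)
  have "s i \<noteq> s j" using ij(2) s(1) Sym_bij[OF s(1)] by (metis bij_cancel(6) less_irrefl)
  moreover have "s i < n" "s j < n" using ij s(1) by (auto simp: Sym_less)
  ultimately show "e \<in> Edges n"
    unfolding Edges_def ij(1) by (cases "s i < s j") (auto, metis insert_commute linorder_neqE_nat)
qed

lemma graph_act_inv: 
  assumes "s \<in> Sym n"
  shows "graph_act s (graph_act (inv s) G) = G" "graph_act (inv s) (graph_act s G) = G"
  using assms by (simp_all add: graph.comp[symmetric] graph.id)

lemma graph_act_Vn: "s \<in> Sym n \<Longrightarrow> graph_act s G \<in> Vn n \<longleftrightarrow> G \<in> Vn n"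
  using graph_act_Edges[of s n G] graph_act_Edges[of "inv s" n "graph_act s G"]
  by (auto simp: Vn_def graph_act_inv)

lemma act_monom:
  assumes s: "s \<in> Sym n"
  shows "act s (monom n S) = monom n (graph_act s S)"
proof
  fix G
  have mono: "A \<subseteq> B \<Longrightarrow> graph_act u A \<subseteq> graph_act u B" for u A B by (auto simp: graph_act_def)
  have "S \<subseteq> graph_act (inv s) G \<longleftrightarrow> graph_act s S \<subseteq> G"
    using mono[of S "graph_act (inv s) G" s] mono[of "graph_act s S" G "inv s"]
    by (auto simp: graph_act_inv[OF s])
  then show "act s (monom n S) G = monom n (graph_act s S) G"
    using s by (simp add: act_eq monom_def graph_act_Vn)
qed

lemma act_linear:
  "act s (\<lambda>x. c * g x + h x) = (\<lambda>x. c * act s g x + act s h x)"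
  by (simp add: act_def)

lemma fsubspace_Vdeg: "fsubspace (Vdeg n d)"
  unfolding Vdeg_def by (rule fsubspace_fspan)

lemma act_fspan:
  assumes "f \<in> fspan A" "\<And>g. g \<in> A \<Longrightarrow> act s g \<in> fspan B"
  shows "act s f \<in> fspan B"
  using assms(1)
proof (induction rule: fspan_induct)
  case zero show ?case using fsubspace_zero[OF fsubspace_fspan] by (simp add: act_def)
next
  case (scale_add c g h)
  then show ?case unfolding act_linear
    using assms(2) by (simp add: fsubspace_add[OF fsubspace_fspan] fsubspace_scale[OF fsubspace_fspan])
qed

lemma act_Vdeg:
  assumes "s \<in> Sym n" "f \<in> Vdeg n d" shows "act s f \<in> Vdeg n d"
  using assms(2) unfolding Vdeg_def
proof (rule act_fspan)
  fix g assume "g \<in> monom n ` {S. S \<subseteq> Edges n \<and> card S \<le> d}"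
  then obtain S where S: "S \<subseteq> Edges n" "card S \<le> d" "g = monom n S" by blast
  then have "finite S" using S finite_subset[OF _ finite_Edges] by blast
  then have "card (graph_act s S) \<le> d"
    unfolding graph_act_def using card_image_le[of S "\<lambda>e. s ` e"] S(2) by simp
  then have "act s g \<in> monom n ` {S. S \<subseteq> Edges n \<and> card S \<le> d}"
    using S assms(1) by (auto simp: act_monom graph_act_Edges)
  then show "act s g \<in> fspan (monom n ` {S. S \<subseteq> Edges n \<and> card S \<le> d})"
    by (rule fspan_base)
qed

lemma gop_in_subspace:
  assumes "fsubspace U" "\<And>s. s \<in> Sym n \<Longrightarrow> act s f \<in> U"
  shows "gop n graph_act \<phi> f \<in> U"
  unfolding gop_def
  using fsubspace_sum[OF assms(1), of "Sym n" "\<lambda>s x. \<phi> s * act s f x"] assms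
  by (simp add: act_eq fsubspace_scale)

lemma fsubspace_isotypic: "fsubspace (isotypic n d lam)"
  unfolding isotypic_def by (rule fsubspace_fspan)

lemma act_isotypic:
  assumes "s \<in> Sym n" "f \<in> isotypic n d lam" shows "act s f \<in> isotypic n d lam"
  using assms(2) unfolding isotypic_def
proof (rule act_fspan)
  fix g assume "g \<in> \<Union>{U. U \<subseteq> Vdeg n d \<and> fsubspace U \<and> act_invariant_set n U \<and> iso_Specht n lam U}" (is "_ \<in> ?X")
  then obtain U where U: "g \<in> U" "U \<subseteq> Vdeg n d" "fsubspace U" "act_invariant_set n U" "iso_Specht n lam U"
    by blast
  then have "act s g \<in> U" using assms(1) by (simp add: act_invariant_set_def)
  then have "act s g \<in> ?X" using U by blast
  then show "act s g \<in> fspan ?X" by (rule fspan_base)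
qed

text \<open>Letting lifts of Specht elements act on \<open>m\<close> is equivariant, and
  \<open>hat_gop_inj\<close> makes it injective as soon as the Young symmetrizer does not kill
  \<open>m\<close>. Its image is a copy of the Specht module inside \<open>Vdeg n d\<close>, and the
  polytabloid is sent to the element in question.\<close>

lemma young_isotypic:
  assumes lam: "is_partition n lam" and t: "is_tableau n lam t" and m: "m \<in> Vdeg n d"
  shows "gop n graph_act (young n lam t) m \<in> isotypic n d lam"
proof (cases "gop n graph_act (young n lam t) m = (\<lambda>_. 0)")
  case True
  then show ?thesis using fsubspace_zero[OF fsubspace_isotypic] by simp
next
  case nz: False
  let ?M = "Specht n lam"
  define \<Phi> where "\<Phi> F = gop n graph_act (hat lam t F) m" for F
  define U where "U = \<Phi> ` ?M"
  have subM: "fsubspace ?M" unfolding Specht_def by (rule fsubspace_fspan)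
  have add: "\<Phi> (\<lambda>T. F T + G T) = (\<lambda>x. \<Phi> F x + \<Phi> G x)" for F G
    unfolding \<Phi>_def gop_add_left[symmetric] by (simp add: hat_def gop_def)
  have scale: "\<Phi> (\<lambda>T. c * F T) = (\<lambda>x. c * \<Phi> F x)" for F c
    unfolding \<Phi>_def gop_scale_left[symmetric] by (simp add: hat_def gop_def)
  have equiv: "\<Phi> (tabloid_act s F) = act s (\<Phi> F)" if "s \<in> Sym n" for s F
    unfolding \<Phi>_def hat_act[OF that] graph.gop_gop[symmetric] using that by (simp add: gop_delta act_eq)
  have inj: "inj_on \<Phi> ?M"
  proof (rule inj_onI)
    fix F G assume FG: "F \<in> ?M" "G \<in> ?M" "\<Phi> F = \<Phi> G"
    let ?D = "\<lambda>T. F T + (-1) * G T"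
    have "?D \<in> ?M" by (intro fsubspace_add[OF subM] fsubspace_scale[OF subM] FG)
    moreover have "\<Phi> ?D = (\<lambda>_. 0)" using FG(3) by (simp only: add scale) simp
    ultimately have "?D = (\<lambda>_. 0)" using graph.hat_gop_inj[OF lam t _ _ nz] by (simp add: \<Phi>_def)
    then show "F = G" by (simp add: fun_eq_iff)
  qed
  have actM: "tabloid_act s F \<in> ?M" if s: "s \<in> Sym n" and F: "F \<in> ?M" for s F
    using F unfolding Specht_eq[OF t]
  proof (induction rule: fspan_induct)
    case zero show ?case using fsubspace_zero[OF fsubspace_fspan] by (simp add: tabloid_act_def)
  next
    case (scale_add c g h)
    then obtain u where u: "u \<in> Sym n" "g = tabloid_act u (polytabloid n lam t)" by blast
    have "tabloid_act s g = tabloid_act (s \<circ> u) (polytabloid n lam t)"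
      using s u by (simp add: tabloid_act_eq tabl.comp)
    then have "tabloid_act s g \<in> fspan ((\<lambda>s. tabloid_act s (polytabloid n lam t)) ` Sym n)"
      using s u by (auto intro!: fspan_base)
    moreover have "tabloid_act s (\<lambda>x. c * g x + h x) = (\<lambda>x. c * tabloid_act s g x + tabloid_act s h x)"
      by (simp add: tabloid_act_def)
    ultimately show ?case using scale_add.IH
      by (simp add: fsubspace_add[OF fsubspace_fspan] fsubspace_scale[OF fsubspace_fspan])
  qed
  have "U \<subseteq> Vdeg n d"
    unfolding U_def \<Phi>_def using gop_in_subspace[OF fsubspace_Vdeg] act_Vdeg[OF _ m] by blast
  moreover have "fsubspace U"
    unfolding fsubspace_def
  proof (intro conjI ballI allI)
    show "(\<lambda>x. 0) \<in> U" unfolding U_def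
      by (rule image_eqI[of _ _ "\<lambda>_. 0"]) (use fsubspace_zero[OF subM] in \<open>simp_all add: \<Phi>_def hat_def gop_def\<close>)
    show "(\<lambda>x. f x + g x) \<in> U" if "f \<in> U" "g \<in> U" for f g
      using that add fsubspace_add[OF subM] unfolding U_def by (auto simp: image_iff) metis
    show "(\<lambda>x. c * f x) \<in> U" if "f \<in> U" for c f
      using that scale fsubspace_scale[OF subM] unfolding U_def by (auto simp: image_iff) metis
  qed
  moreover have "act_invariant_set n U"
    unfolding act_invariant_set_def U_def using equiv actM by (metis (no_types, lifting) imageE imageI)
  moreover have "iso_Specht n lam U"
  proof -
    define \<psi> where "\<psi> = inv_into ?M \<Phi>"
    have b: "bij_betw \<psi> U ?M" unfolding \<psi>_def U_def
      by (rule bij_betw_inv_into) (rule inj_on_imp_bij_betw[OF inj])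
    have \<psi>: "\<psi> (\<Phi> F) = F" if "F \<in> ?M" for F
      unfolding \<psi>_def by (rule inv_into_f_f[OF inj that])
    show ?thesis unfolding iso_Specht_def
    proof (intro exI[of _ \<psi>] conjI ballI allI b)
      fix f g assume "f \<in> U" "g \<in> U"
      then obtain F G where "F \<in> ?M" "G \<in> ?M" "f = \<Phi> F" "g = \<Phi> G" by (auto simp: U_def)
      then show "\<psi> (\<lambda>x. f x + g x) = (\<lambda>T. \<psi> f T + \<psi> g T)"
        by (simp add: \<psi> add[symmetric] fsubspace_add[OF subM])
    next
      fix c f assume "f \<in> U"
      then obtain F where "F \<in> ?M" "f = \<Phi> F" by (auto simp: U_def)
      then show "\<psi> (\<lambda>x. c * f x) = (\<lambda>T. c * \<psi> f T)"
        by (simp add: \<psi> scale[symmetric] fsubspace_scale[OF subM])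
    next
      fix s f assume "s \<in> Sym n" "f \<in> U"
      then obtain F where "F \<in> ?M" "f = \<Phi> F" by (auto simp: U_def)
      then show "\<psi> (act s f) = tabloid_act s (\<psi> f)"
        using \<open>s \<in> Sym n\<close> by (simp add: \<psi> equiv[symmetric] actM)
    qed
  qed
  ultimately have "U \<subseteq> isotypic n d lam"
    unfolding isotypic_def by (intro order_trans[OF _ fspan_sub]) blast
  moreover have "gop n graph_act (young n lam t) m \<in> U"
    unfolding U_def
  proof (rule image_eqI)
    show "gop n graph_act (young n lam t) m = \<Phi> (polytabloid n lam t)"
      unfolding \<Phi>_def by (rule gop_cong) (simp add: hat_polytabloid[OF t])
    show "polytabloid n lam t \<in> ?M"
      unfolding Specht_def using t by (intro fspan_base) blast
  qed
  ultimately show ?thesis by blast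
qed

text \<open>Each conjugate first moves \<open>f\<close> within \<open>Vdeg n d\<close>, then applies
  the Young symmetrizer, then moves the result within the isotypic component.\<close>

lemma cyoung_isotypic:
  assumes lam: "is_partition n lam" and t: "is_tableau n lam t" and f: "f \<in> Vdeg n d"
  shows "gop n graph_act (cyoung n lam t) f \<in> isotypic n d lam"
  unfolding cyoung_def graph.gop_cavg'
proof (rule fsubspace_sum[OF fsubspace_isotypic])
  fix s assume s: "s \<in> Sym n"
  have "gop n graph_act (delta (inv s)) f \<in> Vdeg n d"
    using act_Vdeg[OF Sym_inv[OF s] f] s by (simp add: gop_delta act_eq)
  from young_isotypic[OF lam t this]
  have "act s (gop n graph_act (young n lam t) (gop n graph_act (delta (inv s)) f)) \<in> isotypic n d lam"
    by (rule act_isotypic[OF s])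
  then show "gop n graph_act (delta s) (gop n graph_act (young n lam t) (gop n graph_act (delta (inv s)) f)) \<in> isotypic n d lam"
    using s by (simp add: gop_delta[OF s] act_eq)
qed

subsection \<open>Vanishing outside the lexicographic range\<close>

text \<open>Lists of ones are lexicographically least among positive lists of given sum: the first
  entry that differs from 1 exceeds it.\<close>

lemma replicate_one_lexord:
  assumes "\<forall>x\<in>set xs. 0 < x" "sum_list xs = k"
  shows "map int xs = replicate k 1 \<or> (replicate k 1, map int xs) \<in> lexord {(a, b). a < b}"
  using assms
proof (induction xs arbitrary: k)
  case (Cons y ys)
  then obtain k' where k: "k = Suc k'" by (cases k) auto
  show ?case
  proof (cases "y = 1")
    case True
    then have "sum_list ys = k'" using Cons.prems k by simp
    then show ?thesis using Cons.IH[of k'] Cons.prems True k by auto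
  next
    case False
    then have "1 < int y" using Cons.prems by auto
    then show ?thesis using k by simp
  qed
qed simp

text \<open>A first part above n - 2d already beats the hook, and an equal one leaves a tail of sum
  2d that is at least a list of ones. Integer entries keep the comparison meaningful when n <
  2d.\<close>

lemma not_Lambda_first_row:
  assumes n: "0 < n" and lam: "is_partition n lam" and "lam \<notin> Lambda n d"
  shows "lam \<noteq> []" "lam ! 0 + 2 * d < n"
proof -
  obtain x xs where x: "lam = x # xs"
    using lam n by (cases lam) (auto simp: is_partition_def)
  then show "lam \<noteq> []" by simp
  have no: "map int lam \<noteq> hook n d" "(hook n d, map int lam) \<notin> lexord {(a, b). a < b}"
    using assms by (auto simp: Lambda_def)
  have "\<not> int n - 2 * int d < int x" using no(2) by (simp add: hook_def x)
  moreover have "int n - 2 * int d \<noteq> int x"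
  proof
    assume e: "int n - 2 * int d = int x"
    then have "sum_list xs = 2 * d" using lam by (simp add: is_partition_def x)
    then have "map int xs = replicate (2 * d) 1 \<or> (replicate (2 * d) 1, map int xs) \<in> lexord {(a, b). a < b}"
      using replicate_one_lexord[of xs "2 * d"] lam by (simp add: is_partition_def x)
    then show False using no e by (simp add: hook_def x)
  qed
  ultimately show "lam ! 0 + 2 * d < n" by (simp add: x)
qed

text \<open>Two vertices not occurring in the monomial lie in the same column, by the pigeonhole principle, and
  their transposition fixes the monomial.\<close>

lemma colsym_Vdeg_zero:
  assumes n: "0 < n" and lam: "is_partition n lam" and t: "is_tableau n lam t"
    and nL: "lam \<notin> Lambda n d" and f: "f \<in> Vdeg n d"
  shows "gop n graph_act (colsym n lam t) f = (\<lambda>_. 0)"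
  using f unfolding Vdeg_def
proof (induction rule: fspan_induct)
  case (scale_add c g h)
  then obtain S where S: "S \<subseteq> Edges n" "card S \<le> d" "g = monom n S" by blast
  have lam0: "lam \<noteq> []" "lam ! 0 + 2 * d < n" using not_Lambda_first_row[OF n lam nL] by auto
  then have finS: "finite S" using S finite_subset[OF _ finite_Edges] by blast
  have edge: "card e = 2 \<and> finite e" if "e \<in> S" for e
    using that S(1) by (auto simp: Edges_def)
  have "card (\<Union>S) \<le> (\<Sum>e\<in>S. card e)" by (rule card_Union_le_sum_card)
  also have "\<dots> = 2 * card S" using edge by simp
  finally have cU: "card (\<Union>S) \<le> 2 * d" using S(2) by simp
  define T where "T = {..<n} - \<Union>S"
  have "card {..<n} - card (\<Union>S) \<le> card T"
    unfolding T_def by (rule diff_card_le_card_Diff) (use finS edge in auto)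
  then have "lam ! 0 < card T" using cU lam0 by simp
  moreover have "colof lam t ` T \<subseteq> {..<lam ! 0}"
  proof (clarsimp simp: T_def)
    fix x assume "x < n"
    then have c: "(rowof lam t x, colof lam t x) \<in> cells lam" by (rule tableau_cell(1)[OF t])
    then have "lam ! rowof lam t x \<le> lam ! 0"
      by (intro partition_mono[OF lam]) (auto simp: cells_def)
    then show "colof lam t x < lam ! 0" using c by (simp add: cells_def)
  qed
  ultimately have "\<not> inj_on (colof lam t) T"
    using card_inj_on_le[of "colof lam t" T "{..<lam ! 0}"] by auto
  then obtain i j where ij: "i \<in> T" "j \<in> T" "i \<noteq> j" "colof lam t i = colof lam t j"
    by (auto simp: inj_on_def)
  let ?q = "Transposition.transpose i j"
  have q: "?q \<in> Sym n" using ij by (auto simp: T_def intro: transpose_Sym)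
  have fixS: "graph_act ?q S = S"
  proof -
    have "?q ` e = e" if "e \<in> S" for e
    proof -
      have "?q x = x" if "x \<in> e" for x
        using that ij \<open>e \<in> S\<close> by (intro Transposition.transpose_apply_other) (auto simp: T_def)
      then show ?thesis by simp
    qed
    then show ?thesis by (simp add: graph_act_def)
  qed
  have "gop n graph_act (colsym n lam t) g = (\<lambda>_. 0)"
    unfolding colsym_def
  proof (rule graph.gop_tw_zero[OF col_group_twisted[OF t]])
    show "?q \<in> col_group n lam t" using ij by (intro transpose_col_group[OF t]) (auto simp: T_def)
    show "real_of_int (sign ?q) = -1" using ij by (simp add: sign_swap_id)
    show "g (graph_act (inv ?q) G) = g G" for G
      using fun_cong[OF act_monom[OF q, of S], of G] by (simp add: act_eq fixS S(3))
  qed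
  then show ?case by (simp add: gop_add_right gop_scale_right scale_add.IH)
qed simp

subsection \<open>Decomposition of symmetrized squares\<close>

text \<open>The operator ab: b acts first and kills low-degree elements outside
  \<open>Lambda n d\<close>, and a acts last, leaving the result fixed by the row group.\<close>

definition rcop :: "nat \<Rightarrow> nat list \<Rightarrow> (nat \<times> nat \<Rightarrow> nat) \<Rightarrow> (nat set set \<Rightarrow> real) \<Rightarrow> nat set set \<Rightarrow> real" where
  "rcop n lam t = gop n graph_act (conv n (rowsym n lam t) (colsym n lam t))"

lemma rcop_zero:
  assumes "0 < n" "is_partition n lam" "is_tableau n lam t" "lam \<notin> Lambda n d" "f \<in> Vdeg n d"
  shows "rcop n lam t f = (\<lambda>_. 0)"
  using colsym_Vdeg_zero[OF assms] by (simp add: rcop_def graph.gop_gop[symmetric])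

text \<open>Apply the expansion of the identity to the image \<open>h\<close>. Central elements of
  other shapes annihilate \<open>h\<close>, so \<open>h\<close> is a multiple of the image of
  \<open>h\<close> under its own central element, which is isotypic.\<close>

lemma rcop_Wtab:
  assumes tab: "\<And>lam. is_partition n lam \<Longrightarrow> is_tableau n lam (tab lam)"
    and lam: "is_partition n lam" and f: "f \<in> Vdeg n d"
  shows "rcop n lam (tab lam) f \<in> Wtab n d lam (tab lam)"
proof -
  let ?t = "tab lam"
  note t = tab[OF lam]
  define h where "h = rcop n lam ?t f"
  have hV: "h \<in> Vdeg n d"
    unfolding h_def rcop_def by (rule gop_in_subspace[OF fsubspace_Vdeg]) (rule act_Vdeg[OF _ f])
  obtain c where c: "\<forall>x\<in>Sym n. delta id x = (\<Sum>mu\<in>partitions n. c mu * cyoung n mu (tab mu) x)"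
    using delta_id_expansion[of n tab, OF tab] by blast
  have "h = gop n graph_act (delta id) h" by (simp add: gop_delta graph.id)
  also have "\<dots> = gop n graph_act (\<lambda>x. \<Sum>mu\<in>partitions n. c mu * cyoung n mu (tab mu) x) h"
    by (rule gop_cong) (simp add: c)
  also have "\<dots> = (\<lambda>x. \<Sum>mu\<in>partitions n. c mu * gop n graph_act (cyoung n mu (tab mu)) h x)"
    by (simp only: gop_sum_left gop_scale_left)
  also have "\<dots> = (\<lambda>x. \<Sum>mu\<in>partitions n. if mu = lam then c lam * gop n graph_act (cyoung n lam ?t) h x else 0)"
  proof (rule ext, rule sum.cong[OF refl])
    fix x mu assume mu: "mu \<in> partitions n"
    then have "gop n graph_act (cyoung n mu (tab mu)) h = (\<lambda>_. 0)" if "mu \<noteq> lam"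
      unfolding h_def rcop_def cyoung_def using that
      by (intro graph.gop_cavg_zero young_conv_row_col tab lam) (auto simp: partitions_def)
    then show "c mu * gop n graph_act (cyoung n mu (tab mu)) h x
      = (if mu = lam then c lam * gop n graph_act (cyoung n lam ?t) h x else 0)" by simp
  qed
  also have "\<dots> = (\<lambda>x. c lam * gop n graph_act (cyoung n lam ?t) h x)"
    by (rule ext, subst sum.delta[OF finite_partitions]) (simp add: partitions_def lam)
  also have "\<dots> \<in> isotypic n d lam"
    by (intro fsubspace_scale[OF fsubspace_isotypic] cyoung_isotypic lam t hV)
  finally have "h \<in> isotypic n d lam" .
  moreover have "act s h = h" if s: "s \<in> row_group n lam ?t" for s
  proof -
    have sS: "s \<in> Sym n" using s by (simp add: row_group_def)
    have "act s h = gop n graph_act (delta s) h" using sS by (simp add: gop_delta act_eq)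
    also have "\<dots> = gop n graph_act (conv n (conv n (delta s) (rowsym n lam ?t)) (colsym n lam ?t)) f"
      unfolding h_def rcop_def by (simp only: graph.gop_gop reg.gop_gop)
    also have "conv n (delta s) (rowsym n lam ?t) = rowsym n lam ?t"
      unfolding rowsym_def gop_delta[OF sS]
      by (rule ext) (simp add: twisted.tw_left[OF row_group_twisted[OF t] twisted.inv_mem[OF row_group_twisted[OF t] s]])
    finally show ?thesis by (simp only: h_def rcop_def)
  qed
  ultimately show ?thesis by (simp add: Wtab_def h_def)
qed

section \<open>The symmetrized product as a bilinear pairing\<close>

definition ip :: "nat \<Rightarrow> (nat set set \<Rightarrow> real) \<Rightarrow> (nat set set \<Rightarrow> real) \<Rightarrow> nat set set \<Rightarrow> real" where
  "ip n f g G = (\<Sum>s\<in>Sym n. f (graph_act (inv s) G) * g (graph_act (inv s) G))"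

lemma symz_ip: "symz n (\<lambda>x. f x * g x) G = ip n f g G / fact n"
  by (simp add: symz_def ip_def act_def)

lemma ip_sum_right: "ip n f (\<lambda>x. \<Sum>i\<in>I. g i x) G = (\<Sum>i\<in>I. ip n f (g i) G)"
  unfolding ip_def sum_distrib_left by (rule sum.swap)

lemma ip_scale_right: "ip n f (\<lambda>x. c * g x) G = c * ip n f g G"
  unfolding ip_def sum_distrib_left by (rule sum.cong) auto

lemma ip_commute: "ip n f g G = ip n g f G"
  by (simp add: ip_def mult.commute)

text \<open>Shifting the summation variable by \<open>t\<close> moves the action to the other
  argument: each permutation is adjoint to its inverse, at every point \<open>G\<close>.\<close>

lemma ip_act:
  assumes t: "t \<in> Sym n"
  shows "ip n f (act t g) G = ip n (act (inv t) f) g G"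
proof -
  have "ip n f (act t g) G = (\<Sum>s\<in>Sym n. f (graph_act t (graph_act (inv (s \<circ> t)) G)) * g (graph_act (inv (s \<circ> t)) G))"
    unfolding ip_def act_eq
  proof (rule sum.cong[OF refl])
    fix s assume s: "s \<in> Sym n"
    have "graph_act (inv (s \<circ> t)) G = graph_act (inv t) (graph_act (inv s) G)"
      using s t by (simp add: graph.comp)
    then show "f (graph_act (inv s) G) * g (graph_act (inv t) (graph_act (inv s) G))
      = f (graph_act t (graph_act (inv (s \<circ> t)) G)) * g (graph_act (inv (s \<circ> t)) G)"
      by (simp only: graph_act_inv[OF t])
  qed
  also have "\<dots> = (\<Sum>s\<in>Sym n. f (graph_act t (graph_act (inv s) G)) * g (graph_act (inv s) G))"
    by (rule sum_Sym_right[OF t])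
  finally show ?thesis using t by (simp add: ip_def act_eq)
qed

lemma gop_act: "gop n graph_act \<phi> f = (\<lambda>x. \<Sum>s\<in>Sym n. \<phi> s * act s f x)"
  by (simp add: gop_def act_eq)

lemma ip_gop:
  "ip n f (gop n graph_act \<phi> g) G = ip n (gop n graph_act (\<lambda>s. \<phi> (inv s)) f) g G"
proof -
  have "ip n f (gop n graph_act \<phi> g) G = (\<Sum>s\<in>Sym n. \<phi> s * ip n (act (inv s) f) g G)"
    unfolding gop_act by (simp add: ip_sum_right ip_scale_right ip_act)
  also have "\<dots> = (\<Sum>s\<in>Sym n. \<phi> (inv s) * ip n (act s f) g G)"
    by (rule sum.reindex_bij_witness[of _ inv inv]) auto
  also have "\<dots> = ip n (gop n graph_act (\<lambda>s. \<phi> (inv s)) f) g G"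
    unfolding gop_act by (simp only: ip_commute[of n _ g] ip_sum_right ip_scale_right)
  finally show ?thesis .
qed

text \<open>Moving ab across the pairing gives the middle element baab. Summing over all
  permutations conjugates it; aa gives the order of the row group, the trace property and bb give
  that of the column group, and the average of ab equals that of ba.\<close>

lemma ip_rcop:
  assumes t: "is_tableau n lam t"
  shows "(\<Sum>s\<in>Sym n. ip n (rcop n lam t (act s f)) (rcop n lam t (act s f)) G)
    = real (card (row_group n lam t)) * real (card (col_group n lam t))
      * ip n f (gop n graph_act (cyoung n lam t) f) G"
proof -
  let ?a = "rowsym n lam t" and ?b = "colsym n lam t"
  let ?m = "conv n ?b (conv n ?a (conv n ?a ?b))"
  interpret r: twisted n "row_group n lam t" "\<lambda>_. 1" by (rule row_group_twisted[OF t])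
  have aa: "conv n ?a (conv n ?a ?b) = (\<lambda>s. real (card (row_group n lam t)) * conv n ?a ?b s)"
    unfolding reg.gop_gop unfolding rowsym_def r.tw_tw gop_scale_left ..
  have "ip n (rcop n lam t h) (rcop n lam t h) G = ip n h (gop n graph_act ?m h) G" for h
  proof -
    have "ip n (rcop n lam t h) (rcop n lam t h) G
        = ip n (gop n graph_act (\<lambda>s. conv n ?a ?b (inv s)) (rcop n lam t h)) h G"
      unfolding rcop_def by (rule ip_gop)
    also have "gop n graph_act (\<lambda>s. conv n ?a ?b (inv s)) (rcop n lam t h)
        = gop n graph_act (conv n ?b ?a) (rcop n lam t h)"
      by (intro gop_cong conv_inv) (simp_all add: rowsym_inv[OF t] colsym_inv[OF t])
    also have "\<dots> = gop n graph_act ?m h"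
      unfolding rcop_def by (simp only: graph.gop_gop reg.gop_gop)
    finally show ?thesis by (simp only: ip_commute)
  qed
  then have "(\<Sum>s\<in>Sym n. ip n (rcop n lam t (act s f)) (rcop n lam t (act s f)) G)
      = (\<Sum>s\<in>Sym n. ip n (act s f) (gop n graph_act ?m (act s f)) G)" by simp
  \<comment> \<open>Moving the outer permutation across the pairing turns a translation of both
    arguments into a conjugation of the operator; the inverse in the reindexing gives it the form of
    \<open>cavg\<close>.\<close>
  also have "\<dots> = (\<Sum>s\<in>Sym n. ip n f (gop n graph_act (delta s) (gop n graph_act ?m (gop n graph_act (delta (inv s)) f))) G)"
  proof (rule sum.reindex_bij_witness[of _ inv inv])
    fix s assume s: "s \<in> Sym n"
    show "ip n f (gop n graph_act (delta (inv s)) (gop n graph_act ?m (gop n graph_act (delta (inv (inv s))) f))) G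
        = ip n (act s f) (gop n graph_act ?m (act s f)) G"
      using ip_act[OF Sym_inv[OF s], of f "gop n graph_act ?m (act s f)" G] s
      by (simp add: gop_delta act_eq)
  qed auto
  also have "\<dots> = ip n f (gop n graph_act (cavg n ?m) f) G"
    unfolding graph.gop_cavg' ip_sum_right ..
  also have "gop n graph_act (cavg n ?m) f = gop n graph_act
      (\<lambda>s. real (card (row_group n lam t)) * real (card (col_group n lam t)) * cyoung n lam t s) f"
  proof (rule gop_cong)
    fix s assume s: "s \<in> Sym n"
    have "cavg n ?m s = real (card (row_group n lam t)) * cavg n (conv n ?b (conv n ?a ?b)) s"
      unfolding aa gop_scale_right by (simp add: cavg_def sum_distrib_left)
    also have "cavg n (conv n ?b (conv n ?a ?b)) s = real (card (col_group n lam t)) * cavg n (conv n ?a ?b) s"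
      unfolding colsym_def by (rule cavg_tw_mult[OF col_group_twisted[OF t] s])
    also have "cavg n (conv n ?a ?b) s = cyoung n lam t s"
      unfolding cyoung_def young_def by (rule cavg_conv_comm[OF s])
    finally show "cavg n ?m s = real (card (row_group n lam t)) * real (card (col_group n lam t)) * cyoung n lam t s"
      by (simp only: mult.assoc)
  qed
  finally show ?thesis by (simp only: gop_scale_left ip_scale_right)
qed

text \<open>The coefficient of each central element is divided by the constant of
  \<open>ip_rcop\<close>. The weights depend on the shape alone, so one choice serves every square
  and every point.\<close>

lemma symz_square:
  assumes tab: "\<And>lam. is_partition n lam \<Longrightarrow> is_tableau n lam (tab lam)"
  shows "\<exists>w. (\<forall>lam\<in>partitions n. w lam \<ge> 0) \<and>
    (\<forall>f G. symz n (\<lambda>x. f x * f x) G = (\<Sum>lam\<in>partitions n. \<Sum>s\<in>Sym n.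
       w lam * symz n (\<lambda>x. rcop n lam (tab lam) (act s f) x * rcop n lam (tab lam) (act s f) x) G))"
proof -
  obtain c where c: "\<forall>lam\<in>partitions n. c lam > 0"
    "\<forall>x\<in>Sym n. delta id x = (\<Sum>lam\<in>partitions n. c lam * cyoung n lam (tab lam) x)"
    using delta_id_expansion[of n tab, OF tab] by blast
  define N where "N lam = real (card (row_group n lam (tab lam))) * real (card (col_group n lam (tab lam)))" for lam
  have N: "N lam > 0" if "lam \<in> partitions n" for lam
  proof -
    have t: "is_tableau n lam (tab lam)" using that tab by (simp add: partitions_def)
    have "finite (row_group n lam (tab lam))" "finite (col_group n lam (tab lam))"
      by (rule finite_subset[OF _ finite_Sym[of n]], auto simp: row_group_def col_group_def)+
    then have "card (row_group n lam (tab lam)) > 0" "card (col_group n lam (tab lam)) > 0"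
      using twisted.id_mem[OF row_group_twisted[OF t]] twisted.id_mem[OF col_group_twisted[OF t]]
      by (auto simp: card_gt_0_iff)
    then show ?thesis by (simp add: N_def)
  qed
  have "symz n (\<lambda>x. f x * f x) G = (\<Sum>lam\<in>partitions n. \<Sum>s\<in>Sym n. c lam / N lam *
      symz n (\<lambda>x. rcop n lam (tab lam) (act s f) x * rcop n lam (tab lam) (act s f) x) G)" for f G
  proof -
    have "f = gop n graph_act (delta id) f" by (simp add: gop_delta graph.id)
    also have "\<dots> = gop n graph_act (\<lambda>x. \<Sum>lam\<in>partitions n. c lam * cyoung n lam (tab lam) x) f"
      by (rule gop_cong) (simp add: c)
    also have "\<dots> = (\<lambda>x. \<Sum>lam\<in>partitions n. c lam * gop n graph_act (cyoung n lam (tab lam)) f x)"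
      by (simp only: gop_sum_left gop_scale_left)
    finally have "ip n f f G = ip n f (\<lambda>x. \<Sum>lam\<in>partitions n. c lam * gop n graph_act (cyoung n lam (tab lam)) f x) G"
      by simp
    also have "\<dots> = (\<Sum>lam\<in>partitions n. c lam * ip n f (gop n graph_act (cyoung n lam (tab lam)) f) G)"
      by (simp only: ip_sum_right ip_scale_right)
    also have "\<dots> = (\<Sum>lam\<in>partitions n. c lam / N lam *
        (\<Sum>s\<in>Sym n. ip n (rcop n lam (tab lam) (act s f)) (rcop n lam (tab lam) (act s f)) G))"
    proof (rule sum.cong[OF refl])
      fix lam assume l: "lam \<in> partitions n"
      then have t: "is_tableau n lam (tab lam)" using tab by (simp add: partitions_def)
      show "c lam * ip n f (gop n graph_act (cyoung n lam (tab lam)) f) G = c lam / N lam *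
        (\<Sum>s\<in>Sym n. ip n (rcop n lam (tab lam) (act s f)) (rcop n lam (tab lam) (act s f)) G)"
        unfolding ip_rcop[OF t] N_def[symmetric] using N[OF l] by simp
    qed
    finally show ?thesis
      unfolding symz_ip by (simp add: sum_divide_distrib sum_distrib_left)
  qed
  moreover have "\<forall>lam\<in>partitions n. c lam / N lam \<ge> 0"
    using c(1) N by (simp add: less_imp_le)
  ultimately show ?thesis by (intro exI[of _ "\<lambda>lam. c lam / N lam"]) blast
qed

section \<open>Gram matrices and the final assembly\<close>

lemma fspan_image_coeffs:
  assumes "f \<in> fspan (P ` {..<l::nat})"
  shows "\<exists>v. f = (\<lambda>x. \<Sum>i<l. v i * P i x)"
  using assms
proof (induction rule: fspan_induct)
  case zero
  show ?case by (intro exI[of _ "\<lambda>_. 0"]) simp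
next
  case (scale_add c g h)
  then obtain k v where k: "k < l" "g = P k" and v: "h = (\<lambda>x. \<Sum>i<l. v i * P i x)" by blast
  \<comment> \<open>The coefficient is added at the index \<open>k\<close> and not at the function
    \<open>P k\<close>, so repetitions in the family \<open>P\<close> do no harm.\<close>
  have "c * g x + h x = (\<Sum>i<l. ((if i = k then c else 0) + v i) * P i x)" for x
    using k by (simp add: v distrib_right sum.distrib if_distrib[of "\<lambda>z. z * _"] sum.delta cong: if_cong)
  then show ?case by (intro exI[of _ "\<lambda>i. (if i = k then c else 0) + v i"] ext)
qed

text \<open>The quadratic form at \<open>x\<close> is a weighted sum of squares of the linear forms
  with coefficients \<open>v e\<close>.\<close>

lemma psd_gram:
  assumes "\<And>e. e \<in> E \<Longrightarrow> w e \<ge> 0"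
  shows "psd l (\<lambda>i j. \<Sum>e\<in>E. w e * (v e i * v e j))"
  unfolding psd_def
proof (intro conjI allI impI)
  show "(\<Sum>e\<in>E. w e * (v e i * v e j)) = (\<Sum>e\<in>E. w e * (v e j * v e i))" for i j
    by (simp add: mult.commute)
  fix x :: "nat \<Rightarrow> real"
  have "(\<Sum>i<l. \<Sum>j<l. x i * (\<Sum>e\<in>E. w e * (v e i * v e j)) * x j)
      = (\<Sum>i<l. \<Sum>j<l. \<Sum>e\<in>E. w e * ((x i * v e i) * (x j * v e j)))"
    unfolding sum_distrib_left sum_distrib_right by (intro sum.cong refl) (simp add: mult_ac)
  also have "\<dots> = (\<Sum>i<l. \<Sum>e\<in>E. \<Sum>j<l. w e * ((x i * v e i) * (x j * v e j)))"
    by (rule sum.cong[OF refl]) (rule sum.swap)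
  also have "\<dots> = (\<Sum>e\<in>E. \<Sum>i<l. \<Sum>j<l. w e * ((x i * v e i) * (x j * v e j)))"
    by (rule sum.swap)
  also have "\<dots> = (\<Sum>e\<in>E. w e * ((\<Sum>i<l. x i * v e i) * (\<Sum>j<l. x j * v e j)))"
    unfolding sum_product by (simp only: sum_distrib_left)
  also have "\<dots> \<ge> 0" by (rule sum_nonneg) (rule mult_nonneg_nonneg[OF assms zero_le_square])
  finally show "(\<Sum>i<l. \<Sum>j<l. x i * (\<Sum>e\<in>E. w e * (v e i * v e j)) * x j) \<ge> 0" .
qed

text \<open>The order \<open>P j\<close>, \<open>P i\<close> is that of the trace, where the entry
  i, j of the matrix meets the entry j, i of Z; commutativity of the product permits it.\<close>

lemma symz_square_coeffs:
  "symz n (\<lambda>x. (\<Sum>i<l. v i * P i x) * (\<Sum>i<l. v i * P i x)) G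
    = (\<Sum>i<l. \<Sum>j<l. (v i * v j) * symz n (\<lambda>x. P j x * P i x) G)"
proof -
  let ?f = "\<lambda>x. \<Sum>i<l. v i * P i x"
  have "ip n ?f ?f G = (\<Sum>i<l. v i * ip n (P i) ?f G)"
    unfolding ip_sum_right[where f = ?f] ip_scale_right by (simp only: ip_commute[of n ?f])
  also have "\<dots> = (\<Sum>i<l. \<Sum>j<l. (v i * v j) * ip n (P i) (P j) G)"
    by (simp only: ip_sum_right ip_scale_right sum_distrib_left mult.assoc)
  also have "\<dots> = (\<Sum>i<l. \<Sum>j<l. (v i * v j) * ip n (P j) (P i) G)"
    by (intro sum.cong refl arg_cong[of _ _ "\<lambda>z. _ * z"] ip_commute)
  finally show ?thesis unfolding symz_ip by (simp add: sum_divide_distrib)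
qed

theorem theorem2p8:
  fixes n d :: nat
    and p :: "nat set set \<Rightarrow> real"
    and tab :: "nat list \<Rightarrow> nat \<times> nat \<Rightarrow> nat"
    and l :: "nat list \<Rightarrow> nat"
    and P :: "nat list \<Rightarrow> nat \<Rightarrow> nat set set \<Rightarrow> real"
  assumes "0 < n" and "0 < d"
    and "p \<in> RVn n"
    and "invariant n p"
    and "d_sos n d p"
    and "\<And>lam. is_partition n lam \<Longrightarrow> is_tableau n lam (tab lam)"
    and "\<And>lam i. is_partition n lam \<Longrightarrow> i < l lam \<Longrightarrow> P lam i \<in> RVn n"
    and "\<And>lam. is_partition n lam \<Longrightarrow>
           Wtab n d lam (tab lam) \<subseteq> fspan (P lam ` {..<l lam})"
  shows "\<exists>R :: nat list \<Rightarrow> nat \<Rightarrow> nat \<Rightarrow> real.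
           (\<forall>lam\<in>Lambda n d. psd (l lam) (R lam)) \<and>
           (\<forall>G\<in>Vn n. p G = (\<Sum>lam\<in>Lambda n d. \<Sum>i<l lam. \<Sum>j<l lam.
               R lam i j * symz n (\<lambda>x. P lam j x * P lam i x) G))"
proof -
  note tab = assms(6)
  obtain fs where fs: "set fs \<subseteq> Vdeg n d" "\<forall>G\<in>Vn n. p G = (\<Sum>f\<leftarrow>fs. (f G)\<^sup>2)"
    using \<open>d_sos n d p\<close> by (auto simp: d_sos_def)
  define F where "F k = fs ! k" for k
  define N where "N = length fs"
  have FV: "F k \<in> Vdeg n d" if "k < N" for k
    using fs(1) that by (auto simp: F_def N_def)
  have pF: "p G = (\<Sum>k<N. F k G * F k G)" if "G \<in> Vn n" for G
    using fs(2) that by (simp add: sum_list_sum_nth F_def N_def power2_eq_square atLeast0LessThan)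
  obtain w where w: "\<forall>lam\<in>partitions n. w lam \<ge> 0"
    and sq: "\<forall>f G. symz n (\<lambda>x. f x * f x) G = (\<Sum>lam\<in>partitions n. \<Sum>s\<in>Sym n.
       w lam * symz n (\<lambda>x. rcop n lam (tab lam) (act s f) x * rcop n lam (tab lam) (act s f) x) G)"
    using symz_square[of n tab, OF tab] by blast
  define q where "q lam e = rcop n lam (tab lam) (act (snd e) (F (fst e)))" for lam e
  \<comment> \<open>One Gram vector for each pair of a summand of the sos representation and a
    permutation.\<close>
  define E where "E = {..<N} \<times> Sym n"
  have L: "Lambda n d \<subseteq> partitions n" by (auto simp: Lambda_def partitions_def)
  have actF: "act (snd e) (F (fst e)) \<in> Vdeg n d" if "e \<in> E" for e
    using that FV act_Vdeg by (auto simp: E_def)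
  have "\<exists>v. q lam e = (\<lambda>x. \<Sum>i<l lam. v i * P lam i x)" if "lam \<in> Lambda n d" "e \<in> E" for lam e
  proof -
    have lam: "is_partition n lam" using that L by (auto simp: partitions_def)
    show ?thesis
      using rcop_Wtab[of n tab, OF tab lam actF[OF that(2)]] assms(8)[OF lam]
      by (intro fspan_image_coeffs) (auto simp: q_def)
  qed
  then obtain v where v: "\<And>lam e. lam \<in> Lambda n d \<Longrightarrow> e \<in> E \<Longrightarrow> q lam e = (\<lambda>x. \<Sum>i<l lam. v lam e i * P lam i x)"
    by metis
  define R where "R lam i j = (\<Sum>e\<in>E. w lam * (v lam e i * v lam e j))" for lam i j
  show ?thesis
  proof (intro exI[of _ R] conjI ballI)
    fix lam assume "lam \<in> Lambda n d"
    then have "0 \<le> w lam" using w L by blast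
    then show "psd (l lam) (R lam)"
      unfolding R_def by (rule psd_gram)
  next
    fix G assume G: "G \<in> Vn n"
    \<comment> \<open>Invariance makes \<open>p\<close> its own average, so each square may be
      replaced by its symmetrization. The sos identity holds only at points of \<open>Vn n\<close>,
      which the action preserves.\<close>
    have "p G = (\<Sum>s\<in>Sym n. act s p G) / fact n"
      using \<open>invariant n p\<close> by (simp add: invariant_def card_Sym)
    also have "(\<Sum>s\<in>Sym n. act s p G) = (\<Sum>s\<in>Sym n. \<Sum>k<N. act s (\<lambda>x. F k x * F k x) G)"
      by (rule sum.cong) (simp_all add: act_eq pF graph_act_Vn G)
    also have "\<dots> / fact n = (\<Sum>k<N. symz n (\<lambda>x. F k x * F k x) G)"
      by (subst sum.swap) (simp add: symz_def sum_divide_distrib)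
    also have "\<dots> = (\<Sum>k<N. \<Sum>lam\<in>partitions n. \<Sum>s\<in>Sym n. w lam * symz n (\<lambda>x. q lam (k, s) x * q lam (k, s) x) G)"
      unfolding q_def fst_conv snd_conv by (intro sum.cong refl sq[THEN spec, THEN spec])
    also have "\<dots> = (\<Sum>lam\<in>partitions n. \<Sum>k<N. \<Sum>s\<in>Sym n. w lam * symz n (\<lambda>x. q lam (k, s) x * q lam (k, s) x) G)"
      by (rule sum.swap)
    also have "\<dots> = (\<Sum>lam\<in>partitions n. \<Sum>e\<in>E. w lam * symz n (\<lambda>x. q lam e x * q lam e x) G)"
      by (simp add: E_def sum.cartesian_product case_prod_beta)
    also have "\<dots> = (\<Sum>lam\<in>Lambda n d. \<Sum>e\<in>E. w lam * symz n (\<lambda>x. q lam e x * q lam e x) G)"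
    proof (rule sum.mono_neutral_right[OF finite_partitions L], rule ballI)
      fix lam assume lam: "lam \<in> partitions n - Lambda n d"
      have "q lam e = (\<lambda>_. 0)" if "e \<in> E" for e
        unfolding q_def using lam actF[OF that] tab
        by (intro rcop_zero[OF \<open>0 < n\<close>]) (auto simp: partitions_def)
      then show "(\<Sum>e\<in>E. w lam * symz n (\<lambda>x. q lam e x * q lam e x) G) = 0"
        by (simp add: symz_def act_def)
    qed
    also have "\<dots> = (\<Sum>lam\<in>Lambda n d. \<Sum>i<l lam. \<Sum>j<l lam.
               R lam i j * symz n (\<lambda>x. P lam j x * P lam i x) G)"
    proof (rule sum.cong[OF refl])
      fix lam assume lam: "lam \<in> Lambda n d"
      let ?Z = "\<lambda>i j. symz n (\<lambda>x. P lam j x * P lam i x) G"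
      have "(\<Sum>e\<in>E. w lam * symz n (\<lambda>x. q lam e x * q lam e x) G)
          = (\<Sum>e\<in>E. \<Sum>i<l lam. \<Sum>j<l lam. w lam * (v lam e i * v lam e j) * ?Z i j)"
        \<comment> \<open>Coefficient vectors \<open>v\<close> are available only for shapes in
          \<open>Lambda n d\<close>; this is why the other shapes are discarded before
          expanding.\<close>
        by (rule sum.cong[OF refl]) (simp only: v[OF lam] symz_square_coeffs, simp only: sum_distrib_left mult.assoc)
      also have "\<dots> = (\<Sum>i<l lam. \<Sum>e\<in>E. \<Sum>j<l lam. w lam * (v lam e i * v lam e j) * ?Z i j)"
        by (rule sum.swap)
      also have "\<dots> = (\<Sum>i<l lam. \<Sum>j<l lam. \<Sum>e\<in>E. w lam * (v lam e i * v lam e j) * ?Z i j)"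
        by (rule sum.cong[OF refl]) (rule sum.swap)
      also have "\<dots> = (\<Sum>i<l lam. \<Sum>j<l lam. R lam i j * ?Z i j)"
        by (simp add: R_def sum_distrib_right)
      finally show "(\<Sum>e\<in>E. w lam * symz n (\<lambda>x. q lam e x * q lam e x) G)
          = (\<Sum>i<l lam. \<Sum>j<l lam. R lam i j * ?Z i j)" .
    qed
    finally show "p G = (\<Sum>lam\<in>Lambda n d. \<Sum>i<l lam. \<Sum>j<l lam.
               R lam i j * symz n (\<lambda>x. P lam j x * P lam i x) G)" .
  qed
qed

end
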